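(* Let $\Phi$ be an irreducible crystallographic reduced root system with positive subsystem $\Phi^+$. The positive length map coincides with the length map, i.e. $|\gamma|_+=|\gamma|$ for all $\gamma\in R^+$, if and only if $\Phi$ is of type $\mathsf{A}_\ell$ ($\ell\geq1$) or of type $\mathsf{C}_\ell$ ($\ell\geq2$).
   Context: $R$ is the $\mathbb{Z}$-span of $\Phi$ and $R^+$ is the $\mathbb{N}$-span of $\Phi^+$. For $\gamma\in R$ the length $|\gamma|$ is the minimum $r\ge0$ such that $\gamma$ is a sum of $r$ roots of $\Phi$ (repetitions allowed). For $\gamma\in R^+$ the positive length $|\gamma|_+$ is the minimum number of positive roots (elements of $\Phi^+$, repetitions allowed) needed to write $\gamma$ as a sum of positive roots. Type $\mathsf{C}_2$ is the same as $\mathsf{B}_2$; type $\mathsf{B}_\ell$ is considered for $\ell\geq3$ and type $\mathsf{D}_\ell$ for $\ell\ge4$. *)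

theory Defs
  imports "HOL-Analysis.Analysis"
begin

definition reflection :: "'a::euclidean_space \<Rightarrow> 'a \<Rightarrow> 'a" where
  "reflection \<alpha> v = v - (2 * (v \<bullet> \<alpha>) / (\<alpha> \<bullet> \<alpha>)) *\<^sub>R \<alpha>"

definition cartan_int :: "'a::euclidean_space \<Rightarrow> 'a \<Rightarrow> real" where
  "cartan_int \<alpha> \<beta> = 2 * (\<alpha> \<bullet> \<beta>) / (\<beta> \<bullet> \<beta>)"

definition root_system :: "'a::euclidean_space set \<Rightarrow> bool" where
  "root_system \<Phi> \<longleftrightarrow>
     finite \<Phi> \<and> 0 \<notin> \<Phi> \<and> span \<Phi> = UNIV \<and> (\<forall>\<alpha>\<in>\<Phi>. reflection \<alpha> ` \<Phi> = \<Phi>)"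

definition reduced_roots :: "'a::euclidean_space set \<Rightarrow> bool" where
  "reduced_roots \<Phi> \<longleftrightarrow> (\<forall>\<alpha>\<in>\<Phi>. \<forall>c::real. c *\<^sub>R \<alpha> \<in> \<Phi> \<longrightarrow> c = 1 \<or> c = -1)"

definition crystallographic :: "'a::euclidean_space set \<Rightarrow> bool" where
  "crystallographic \<Phi> \<longleftrightarrow> (\<forall>\<alpha>\<in>\<Phi>. \<forall>\<beta>\<in>\<Phi>. cartan_int \<alpha> \<beta> \<in> \<int>)"

definition irreducible_roots :: "'a::euclidean_space set \<Rightarrow> bool" where
  "irreducible_roots \<Phi> \<longleftrightarrow> \<Phi> \<noteq> {} \<and>
     \<not> (\<exists>A B. A \<noteq> {} \<and> B \<noteq> {} \<and> A \<union> B = \<Phi> \<and> A \<inter> B = {} \<and> (\<forall>\<alpha>\<in>A. \<forall>\<beta>\<in>B. \<alpha> \<bullet> \<beta> = 0))"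

text \<open>A positive subsystem consists of the roots on one side of a hyperplane that
  contains no root.\<close>

definition positive_subsystem :: "'a::euclidean_space set \<Rightarrow> 'a set \<Rightarrow> bool" where
  "positive_subsystem \<Phi> P \<longleftrightarrow>
     (\<exists>t. (\<forall>\<alpha>\<in>\<Phi>. t \<bullet> \<alpha> \<noteq> 0) \<and> P = {\<alpha>\<in>\<Phi>. t \<bullet> \<alpha> > 0})"

text \<open>Only meaningful for finite \<open>S\<close>.\<close>

definition nat_span :: "'a::euclidean_space set \<Rightarrow> 'a set" where
  "nat_span S = {\<Sum>\<alpha>\<in>S. real (c \<alpha>) *\<^sub>R \<alpha> | c :: 'a \<Rightarrow> nat. True}"

text \<open>The minimal number of summands from \<open>S\<close>, repetitions allowed. For a root system
  \<open>\<Phi>\<close> with positive subsystem \<open>P\<close>, \<open>sum_length \<Phi>\<close> is the length and \<open>sum_length P\<close> the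
  positive length.\<close>

definition sum_length :: "'a::euclidean_space set \<Rightarrow> 'a \<Rightarrow> nat" where
  "sum_length S \<gamma> = (LEAST r. \<exists>xs. length xs = r \<and> set xs \<subseteq> S \<and> sum_list xs = \<gamma>)"

lemma nat_span_imp_sum_list:
  assumes "finite S" and "\<gamma> \<in> nat_span S"
  shows "\<exists>xs. set xs \<subseteq> S \<and> sum_list xs = \<gamma>"
proof -
  obtain c :: "'a \<Rightarrow> nat" where c: "\<gamma> = (\<Sum>\<alpha>\<in>S. real (c \<alpha>) *\<^sub>R \<alpha>)"
    using assms(2) unfolding nat_span_def by blast
  have "\<exists>xs. set xs \<subseteq> S \<and> sum_list xs = (\<Sum>\<alpha>\<in>S. real (c \<alpha>) *\<^sub>R \<alpha>)"
    using assms(1)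
  proof (induction S rule: finite_induct)
    case empty
    show ?case by (intro exI[of _ "[]"]) simp
  next
    case (insert a S)
    then obtain xs where "set xs \<subseteq> S" "sum_list xs = (\<Sum>\<alpha>\<in>S. real (c \<alpha>) *\<^sub>R \<alpha>)"
      by blast
    moreover have "sum_list (replicate n a) = real n *\<^sub>R a" for n
      by (induction n) (simp_all add: algebra_simps)
    ultimately show ?case using insert.hyps
      by (intro exI[of _ "replicate (c a) a @ xs"]) (auto simp: set_replicate_conv_if)
  qed
  then show ?thesis using c by simp
qed

definition root_base :: "'a::euclidean_space set \<Rightarrow> 'a set \<Rightarrow> bool" where
  "root_base \<Phi> \<Delta> \<longleftrightarrow> \<Delta> \<subseteq> \<Phi> \<and> independent \<Delta> \<and> span \<Delta> = UNIV \<and>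
     (\<forall>\<beta>\<in>\<Phi>. \<beta> \<in> nat_span \<Delta> \<or> - \<beta> \<in> nat_span \<Delta>)"

text \<open>The type of a root system is read off from the Cartan matrix of a base
  \<open>s 1, \<dots>, s l\<close>; the entry in row \<open>i\<close> and column \<open>j\<close> is the pairing of \<open>s i\<close> with the
  coroot of \<open>s j\<close>.\<close>

definition has_cartan_matrix ::
    "'a::euclidean_space set \<Rightarrow> nat \<Rightarrow> (nat \<Rightarrow> nat \<Rightarrow> int) \<Rightarrow> bool" where
  "has_cartan_matrix \<Phi> l M \<longleftrightarrow>
     (\<exists>s. inj_on s {1..l} \<and> root_base \<Phi> (s ` {1..l}) \<and>
       (\<forall>i\<in>{1..l}. \<forall>j\<in>{1..l}. cartan_int (s i) (s j) = of_int (M i j)))"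

definition cartan_A :: "nat \<Rightarrow> nat \<Rightarrow> int" where
  "cartan_A i j = (if i = j then 2 else if i = j + 1 \<or> j = i + 1 then -1 else 0)"

text \<open>In type \<open>C\<close> the last simple root is long and the others are short.\<close>

definition cartan_C :: "nat \<Rightarrow> nat \<Rightarrow> nat \<Rightarrow> int" where
  "cartan_C l i j = (if i = l \<and> j + 1 = l then -2 else cartan_A i j)"

definition type_A :: "'a::euclidean_space set \<Rightarrow> nat \<Rightarrow> bool" where
  "type_A \<Phi> l \<longleftrightarrow> l \<ge> 1 \<and> has_cartan_matrix \<Phi> l cartan_A"

definition type_C :: "'a::euclidean_space set \<Rightarrow> nat \<Rightarrow> bool" where
  "type_C \<Phi> l \<longleftrightarrow> l \<ge> 2 \<and> has_cartan_matrix \<Phi> l (cartan_C l)"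

end

(* Idea. In types A and C the roots are the differences of the elements of a set X of weights
   which the vector t defining the positive system orders linearly. If a summand x - y of an element of R^+ is negative, then another
   summand x' - y' passes upwards through the level y, and exchanging x - y, x' - y' for x - y', x' - y
   makes the summands less spread out; repeating this removes all negative summands.
   Conversely, if the lengths agree, every simple root b satisfies sum_{a ~ b} -<b, a^vee> <= 2
   (see row_sum_le_2), and positive definiteness makes one of these sums at most 1. A connected
   Dynkin diagram with these bounds is a path whose only possible multiple bond is a double one at
   the far end, with the last root long: type A or C. *)

theory Submission
  imports Defs
begin

section \<open>Roots and simple reflections\<close>

text \<open>The type is read off from some base, which need not lie in \<open>P\<close>. The
  exchange therefore never refers to the simple roots of \<open>P\<close>; it uses only
  \<open>t\<close> and the set of weights. That a compensating summand exists is detected by a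
  linear functional \<open>\<phi>\<close> that measures passages through the level of y: it is
  nonnegative on \<open>P\<close>, hence on \<gamma>, but negative on the bad summand. In the
  converse only the rows -<b, a^vee> with b fixed are bounded, not the columns, and this asymmetry
  separates C from B. In C_l the entry -2 stands in the row of the long end root, which has no other
  neighbour; in B_l with l \<ge> 3 it stands in the row of a long root that has a second neighbour,
  and the sum is 3. The same sum 3 arises at a branch vertex in types D and E, at the double bond of
  F_4 and at the triple bond of G_2.\<close>

lemma reflection_eq_cartan_int: "reflection \<alpha> v = v - cartan_int v \<alpha> *\<^sub>R \<alpha>"
  by (simp add: reflection_def cartan_int_def)

lemma cartan_int_add: "cartan_int (v + w) \<alpha> = cartan_int v \<alpha> + cartan_int w \<alpha>"
  by (simp add: cartan_int_def inner_add_left add_divide_distrib ring_distribs)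

lemma cartan_int_diff: "cartan_int (v - w) \<alpha> = cartan_int v \<alpha> - cartan_int w \<alpha>"
  by (simp add: cartan_int_def inner_diff_left diff_divide_distrib ring_distribs)

lemma cartan_int_scaleR: "cartan_int (c *\<^sub>R v) \<alpha> = c * cartan_int v \<alpha>"
  by (simp add: cartan_int_def)

lemma cartan_int_self: "\<alpha> \<noteq> 0 \<Longrightarrow> cartan_int \<alpha> \<alpha> = 2"
  by (simp add: cartan_int_def)

lemma reflection_diff: "reflection \<alpha> (v - w) = reflection \<alpha> v - reflection \<alpha> w"
  by (simp add: reflection_eq_cartan_int cartan_int_diff algebra_simps)

lemma reflection_add: "reflection \<alpha> (v + w) = reflection \<alpha> v + reflection \<alpha> w"
  by (simp add: reflection_eq_cartan_int cartan_int_add algebra_simps)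

lemma reflection_scaleR: "reflection \<alpha> (c *\<^sub>R v) = c *\<^sub>R reflection \<alpha> v"
  by (simp add: reflection_eq_cartan_int cartan_int_scaleR algebra_simps)

lemma reflection_reflection: "\<alpha> \<noteq> 0 \<Longrightarrow> reflection \<alpha> (reflection \<alpha> v) = v"
  by (simp add: reflection_eq_cartan_int cartan_int_diff cartan_int_scaleR cartan_int_self
      algebra_simps flip: scaleR_left.add)

lemma nat_spanI: "v = (\<Sum>\<alpha>\<in>S. real (c \<alpha>) *\<^sub>R \<alpha>) \<Longrightarrow> v \<in> nat_span S"
  unfolding nat_span_def by blast

lemma nat_spanE:
  assumes "v \<in> nat_span S"
  obtains c :: "'a::euclidean_space \<Rightarrow> nat" where "v = (\<Sum>\<alpha>\<in>S. real (c \<alpha>) *\<^sub>R \<alpha>)"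
  using assms unfolding nat_span_def by blast

lemma nat_span_base: "finite S \<Longrightarrow> \<alpha> \<in> S \<Longrightarrow> \<alpha> \<in> nat_span S"
  by (rule nat_spanI[where c = "\<lambda>\<beta>. if \<beta> = \<alpha> then 1 else 0"])
    (simp add: sum.delta if_distrib[of "\<lambda>c. real c *\<^sub>R _"] cong: if_cong)

lemma nat_span_add:
  assumes "v \<in> nat_span S" "w \<in> nat_span S"
  shows "v + w \<in> nat_span S"
proof -
  obtain c d where "v = (\<Sum>\<alpha>\<in>S. real (c \<alpha>) *\<^sub>R \<alpha>)" "w = (\<Sum>\<alpha>\<in>S. real (d \<alpha>) *\<^sub>R \<alpha>)"
    using assms unfolding nat_span_def by blast
  then show ?thesis
    by (intro nat_spanI[where c = "\<lambda>\<alpha>. c \<alpha> + d \<alpha>"]) (simp add: sum.distrib scaleR_add_left)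
qed

lemma nat_span_subset_span: "nat_span S \<subseteq> span S"
  unfolding nat_span_def by (auto intro: span_sum span_scale span_base)

lemma linear_nonneg_nat_span:
  fixes \<phi> :: "'a::euclidean_space \<Rightarrow> real"
  assumes "linear \<phi>" "\<And>\<alpha>. \<alpha> \<in> S \<Longrightarrow> \<phi> \<alpha> \<ge> 0" "v \<in> nat_span S"
  shows "\<phi> v \<ge> 0"
proof -
  obtain c where "v = (\<Sum>\<alpha>\<in>S. real (c \<alpha>) *\<^sub>R \<alpha>)"
    using assms(3) by (rule nat_spanE)
  then have "\<phi> v = (\<Sum>\<alpha>\<in>S. real (c \<alpha>) * \<phi> \<alpha>)"
    by (simp add: linear_sum[OF assms(1)] linear_cmul[OF assms(1)])
  then show ?thesis
    using assms(2) by (simp add: sum_nonneg)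
qed

locale root_sys =
  fixes \<Phi> :: "'a::euclidean_space set"
  assumes root_system: "root_system \<Phi>"
    and reduced: "reduced_roots \<Phi>"
    and crystallographic: "crystallographic \<Phi>"
begin

lemma finite_roots: "finite \<Phi>"
  using root_system by (simp add: root_system_def)

lemma root_nonzero: "\<alpha> \<in> \<Phi> \<Longrightarrow> \<alpha> \<noteq> 0"
  using root_system by (auto simp: root_system_def)

lemma span_roots: "span \<Phi> = UNIV"
  using root_system by (simp add: root_system_def)

lemma reflection_root: "\<alpha> \<in> \<Phi> \<Longrightarrow> \<beta> \<in> \<Phi> \<Longrightarrow> reflection \<alpha> \<beta> \<in> \<Phi>"
  using root_system unfolding root_system_def by blast

lemma cartan_int_Ints: "\<alpha> \<in> \<Phi> \<Longrightarrow> \<beta> \<in> \<Phi> \<Longrightarrow> cartan_int \<alpha> \<beta> \<in> \<int>"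
  using crystallographic by (auto simp: crystallographic_def)

lemma uminus_root:
  assumes "\<alpha> \<in> \<Phi>"
  shows "- \<alpha> \<in> \<Phi>"
proof -
  have "reflection \<alpha> \<alpha> = - \<alpha>"
    by (simp add: reflection_eq_cartan_int cartan_int_self[OF root_nonzero[OF assms]] scaleR_2)
  then show ?thesis
    using reflection_root[OF assms assms] by simp
qed

text \<open>Both Cartan integers are positive. If both were at least 2, then \<alpha> - \<beta>
  would have nonpositive square norm; so one of them is 1, and the corresponding reflection yields
  the difference up to sign.\<close>

lemma diff_root:
  assumes "\<alpha> \<in> \<Phi>" "\<beta> \<in> \<Phi>" "\<alpha> \<noteq> \<beta>" "\<alpha> \<bullet> \<beta> > 0"
  shows "\<alpha> - \<beta> \<in> \<Phi>"
proof -
  have pos: "\<alpha> \<bullet> \<alpha> > 0" "\<beta> \<bullet> \<beta> > 0"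
    using root_nonzero assms by auto
  obtain p q :: int where p: "cartan_int \<alpha> \<beta> = p" and q: "cartan_int \<beta> \<alpha> = q"
    using cartan_int_Ints assms by (meson Ints_cases)
  have eq: "2 * (\<alpha> \<bullet> \<beta>) = p * (\<beta> \<bullet> \<beta>)" "2 * (\<alpha> \<bullet> \<beta>) = q * (\<alpha> \<bullet> \<alpha>)"
    using p q pos by (auto simp: cartan_int_def field_simps inner_commute)
  have "p > 0" "q > 0"
    using eq pos assms(4) zero_less_mult_pos2[of "real_of_int p" "\<beta> \<bullet> \<beta>"]
      zero_less_mult_pos2[of "real_of_int q" "\<alpha> \<bullet> \<alpha>"] by simp_all
  have "p = 1 \<or> q = 1"
  proof (rule ccontr)
    assume "\<not> (p = 1 \<or> q = 1)"
    then have "real_of_int p \<ge> 2" "real_of_int q \<ge> 2"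
      using \<open>p > 0\<close> \<open>q > 0\<close> by auto
    then have "2 * (\<alpha> \<bullet> \<beta>) \<ge> 2 * (\<beta> \<bullet> \<beta>)" "2 * (\<alpha> \<bullet> \<beta>) \<ge> 2 * (\<alpha> \<bullet> \<alpha>)"
      using mult_right_mono[of 2 "real_of_int p" "\<beta> \<bullet> \<beta>"]
        mult_right_mono[of 2 "real_of_int q" "\<alpha> \<bullet> \<alpha>"] eq pos by linarith+
    then have "(\<alpha> - \<beta>) \<bullet> (\<alpha> - \<beta>) \<le> 0"
      by (simp add: inner_diff inner_commute)
    then show False
      using assms(3) by (metis inner_gt_zero_iff not_le right_minus_eq)
  qed
  then show ?thesis
  proof
    assume "p = 1"
    then show ?thesis
      using reflection_root[OF assms(2,1)] p by (simp add: reflection_eq_cartan_int)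
  next
    assume "q = 1"
    then have "\<beta> - \<alpha> \<in> \<Phi>"
      using reflection_root[OF assms(1,2)] q by (simp add: reflection_eq_cartan_int)
    then show ?thesis
      using uminus_root by fastforce
  qed
qed

end

section \<open>Coordinates over a base and induction along simple reflections\<close>

locale root_sys_base = root_sys \<Phi> for \<Phi> :: "'a::euclidean_space set" +
  fixes \<Delta> :: "'a set"
  assumes root_base: "root_base \<Phi> \<Delta>"
begin

lemma simple_root: "\<alpha> \<in> \<Delta> \<Longrightarrow> \<alpha> \<in> \<Phi>"
  using root_base by (auto simp: root_base_def)

lemma independent_base: "independent \<Delta>"
  using root_base by (simp add: root_base_def)

lemma span_simple_roots: "span \<Delta> = UNIV"
  using root_base by (simp add: root_base_def)

lemma finite_base: "finite \<Delta>"
  using finite_subset[of \<Delta> \<Phi>] finite_roots simple_root by blast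

lemma root_sign: "\<beta> \<in> \<Phi> \<Longrightarrow> \<beta> \<in> nat_span \<Delta> \<or> - \<beta> \<in> nat_span \<Delta>"
  using root_base by (auto simp: root_base_def)

definition coord :: "'a \<Rightarrow> 'a \<Rightarrow> real" where
  "coord \<alpha> v = representation \<Delta> v \<alpha>"

lemma linear_coord: "linear (coord \<alpha>)"
  by (rule linearI)
    (simp_all add: coord_def representation_add representation_scale independent_base span_simple_roots)

lemma coord_simple: "\<alpha> \<in> \<Delta> \<Longrightarrow> coord \<beta> \<alpha> = (if \<alpha> = \<beta> then 1 else 0)"
  by (auto simp: coord_def representation_basis independent_base)

lemma sum_coord: "(\<Sum>\<alpha>\<in>\<Delta>. coord \<alpha> v *\<^sub>R \<alpha>) = v"
  unfolding coord_def
  by (rule sum_representation_eq) (simp_all add: independent_base span_simple_roots finite_base)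

lemma coord_Nats:
  assumes "v \<in> nat_span \<Delta>" "\<alpha> \<in> \<Delta>"
  shows "coord \<alpha> v \<in> \<nat>"
proof -
  obtain c where "v = (\<Sum>\<alpha>\<in>\<Delta>. real (c \<alpha>) *\<^sub>R \<alpha>)"
    using assms(1) by (rule nat_spanE)
  then have "coord \<alpha> v = (\<Sum>\<beta>\<in>\<Delta>. real (c \<beta>) * coord \<alpha> \<beta>)"
    by (simp add: linear_sum[OF linear_coord] linear_cmul[OF linear_coord])
  also have "\<dots> = (\<Sum>\<beta>\<in>\<Delta>. if \<alpha> = \<beta> then real (c \<beta>) else 0)"
    by (rule sum.cong) (auto simp: coord_simple)
  also have "\<dots> = real (c \<alpha>)"
    using assms(2) finite_base by (simp add: sum.delta')
  finally show ?thesis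
    by simp
qed

lemma coord_nonneg: "v \<in> nat_span \<Delta> \<Longrightarrow> \<alpha> \<in> \<Delta> \<Longrightarrow> coord \<alpha> v \<ge> 0"
  using coord_Nats[of v \<alpha>] by (auto simp: Nats_def)

text \<open>A reflection in \<alpha> changes only the \<alpha>-coordinate. If the image were
  negative, all other coordinates of \<beta> would vanish, so \<beta> would be a positive multiple
  of \<alpha>, which in a reduced system is \<alpha> itself.\<close>

lemma reflection_positive:
  assumes "\<beta> \<in> \<Phi>" "\<beta> \<in> nat_span \<Delta>" "\<alpha> \<in> \<Delta>" "\<beta> \<noteq> \<alpha>"
  shows "reflection \<alpha> \<beta> \<in> nat_span \<Delta>"
proof (rule ccontr)
  let ?\<mu> = "reflection \<alpha> \<beta>"
  assume "?\<mu> \<notin> nat_span \<Delta>"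
  then have neg: "- ?\<mu> \<in> nat_span \<Delta>"
    using root_sign[OF reflection_root[OF simple_root[OF assms(3)] assms(1)]] by blast
  have zero: "coord \<delta> \<beta> = 0" if "\<delta> \<in> \<Delta>" "\<delta> \<noteq> \<alpha>" for \<delta>
  proof -
    have "coord \<delta> (- ?\<mu>) = - coord \<delta> \<beta>"
      using that assms(3)
      by (simp add: reflection_eq_cartan_int linear_diff[OF linear_coord]
          linear_cmul[OF linear_coord] coord_simple)
    then show ?thesis
      using coord_nonneg[OF neg that(1)] coord_nonneg[OF assms(2) that(1)] by simp
  qed
  have "\<beta> = (\<Sum>\<delta>\<in>\<Delta>. if \<delta> = \<alpha> then coord \<alpha> \<beta> *\<^sub>R \<alpha> else 0)"
    by (subst sum_coord[symmetric], rule sum.cong) (auto simp: zero)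
  then have \<beta>: "\<beta> = coord \<alpha> \<beta> *\<^sub>R \<alpha>"
    using assms(3) finite_base by (simp add: sum.delta)
  have "coord \<alpha> \<beta> *\<^sub>R \<alpha> \<in> \<Phi>"
    by (subst \<beta>[symmetric]) (rule assms(1))
  then have "coord \<alpha> \<beta> = 1 \<or> coord \<alpha> \<beta> = - 1"
    using simple_root[OF assms(3)] reduced unfolding reduced_roots_def by blast
  then have "coord \<alpha> \<beta> = 1"
    using coord_nonneg[OF assms(2,3)] by auto
  then show False
    using \<beta> assms(4) by simp
qed

text \<open>Descent on the height. Since \<beta> \<bullet> \<beta> > 0, some simple \<alpha> has
  both a positive coordinate in \<beta> and a positive inner product with \<beta>; reflecting in it
  lowers the height and, for nonsimple \<beta>, keeps the root positive.\<close>

lemma positive_root_induct [consumes 2, case_names simple reflection]: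
  assumes "\<beta> \<in> \<Phi>" "\<beta> \<in> nat_span \<Delta>"
    and simple: "\<And>\<alpha>. \<alpha> \<in> \<Delta> \<Longrightarrow> Q \<alpha>"
    and reflection: "\<And>\<alpha> \<mu>. \<alpha> \<in> \<Delta> \<Longrightarrow> Q \<mu> \<Longrightarrow> Q (reflection \<alpha> \<mu>)"
  shows "Q \<beta>"
proof -
  define height where "height v = (\<Sum>\<alpha>\<in>\<Delta>. coord \<alpha> v)" for v
  have "height v \<in> \<nat>" if "v \<in> nat_span \<Delta>" for v
  proof -
    have "(\<Sum>\<alpha>\<in>A. coord \<alpha> v) \<in> \<nat>" if "A \<subseteq> \<Delta>" for A
      using finite_subset[OF that finite_base] that coord_Nats[OF \<open>v \<in> nat_span \<Delta>\<close>]
      by (induction A rule: finite_induct) auto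
    then show ?thesis
      by (simp add: height_def)
  qed
  then obtain n where "height \<beta> = real n"
    using assms(2) by (meson Nats_cases)
  with assms(1,2) show ?thesis
  proof (induction n arbitrary: \<beta> rule: less_induct)
    case (less n)
    show ?case
    proof (cases "\<beta> \<in> \<Delta>")
      case True
      then show ?thesis by (rule simple)
    next
      case False
      have "0 < \<beta> \<bullet> \<beta>"
        using root_nonzero[OF less.prems(1)] by simp
      also have "\<beta> \<bullet> \<beta> = (\<Sum>\<alpha>\<in>\<Delta>. coord \<alpha> \<beta> * (\<beta> \<bullet> \<alpha>))"
        by (subst (2) sum_coord[symmetric]) (simp add: inner_sum_right)
      finally have "\<not> (\<forall>\<alpha>\<in>\<Delta>. coord \<alpha> \<beta> * (\<beta> \<bullet> \<alpha>) \<le> 0)"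
        using sum_nonpos[of \<Delta> "\<lambda>\<alpha>. coord \<alpha> \<beta> * (\<beta> \<bullet> \<alpha>)"] by auto
      then obtain \<alpha> where \<alpha>: "\<alpha> \<in> \<Delta>" "coord \<alpha> \<beta> * (\<beta> \<bullet> \<alpha>) > 0"
        by (auto simp: not_le)
      then have "\<beta> \<bullet> \<alpha> > 0"
        using coord_nonneg[OF less.prems(2) \<alpha>(1)] by (simp add: zero_less_mult_iff)
      then have pos: "cartan_int \<beta> \<alpha> > 0"
        using root_nonzero[OF simple_root[OF \<alpha>(1)]] by (simp add: cartan_int_def)
      let ?\<mu> = "reflection \<alpha> \<beta>"
      have \<mu>: "?\<mu> \<in> \<Phi>" "?\<mu> \<in> nat_span \<Delta>"
        using reflection_root[OF simple_root[OF \<alpha>(1)] less.prems(1)]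
          reflection_positive[OF less.prems(1,2) \<alpha>(1)] \<alpha>(1) False by auto
      have "height \<alpha> = 1"
        using \<alpha>(1) finite_base by (simp add: height_def coord_simple)
      then have "height ?\<mu> = height \<beta> - cartan_int \<beta> \<alpha>"
        unfolding reflection_eq_cartan_int height_def
        by (simp add: linear_diff[OF linear_coord] linear_cmul[OF linear_coord] sum_subtractf
            flip: sum_distrib_left)
      moreover obtain m where m: "height ?\<mu> = real m"
        using \<open>\<And>v. v \<in> nat_span \<Delta> \<Longrightarrow> height v \<in> \<nat>\<close> \<mu>(2) by (meson Nats_cases)
      ultimately have "m < n"
        using less.prems(3) pos by simp
      then have "Q ?\<mu>"
        using less.IH \<mu> m by blast
      then have "Q (reflection \<alpha> ?\<mu>)"
        by (rule reflection[OF \<alpha>(1)])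
      then show ?thesis
        by (simp add: reflection_reflection root_nonzero simple_root \<alpha>(1))
    qed
  qed
qed

text \<open>A set stable under the simple reflections has a stable set of differences, and every
  positive root arises from a simple one by simple reflections. This bounds \<open>\<Phi>\<close>
  from above when only the Cartan matrix is known.\<close>

lemma roots_subset_differences:
  assumes "\<And>\<alpha>. \<alpha> \<in> \<Delta> \<Longrightarrow> \<exists>x\<in>X. \<exists>y\<in>X. \<alpha> = x - y"
    and "\<And>\<alpha> x. \<alpha> \<in> \<Delta> \<Longrightarrow> x \<in> X \<Longrightarrow> reflection \<alpha> x \<in> X"
    and "\<beta> \<in> \<Phi>"
  shows "\<exists>x\<in>X. \<exists>y\<in>X. \<beta> = x - y"
proof -
  have pos: "\<exists>x\<in>X. \<exists>y\<in>X. \<mu> = x - y" if "\<mu> \<in> \<Phi>" "\<mu> \<in> nat_span \<Delta>" for \<mu>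
    using that
  proof (induction rule: positive_root_induct)
    case (simple \<alpha>)
    then show ?case by (rule assms(1))
  next
    case (reflection \<alpha> \<mu>)
    then show ?case
      using assms(2) reflection_diff by metis
  qed
  show ?thesis
  proof (cases "\<beta> \<in> nat_span \<Delta>")
    case True
    then show ?thesis using pos assms(3) by blast
  next
    case False
    then obtain x y where "x \<in> X" "y \<in> X" "- \<beta> = x - y"
      using pos[of "- \<beta>"] root_sign uminus_root assms(3) by blast
    then show ?thesis
      by (metis minus_diff_eq minus_minus)
  qed
qed

end

section \<open>Exchanging summands\<close>

lemma sum_length_le: "set xs \<subseteq> S \<Longrightarrow> sum_list xs = \<gamma> \<Longrightarrow> sum_length S \<gamma> \<le> length xs"
  unfolding sum_length_def by (rule Least_le) blast

text \<open>Without a witnessing list the \<open>LEAST\<close> in \<open>sum_length\<close> would be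
  an unspecified number, so one has to be supplied before the minimum can be realised.\<close>

lemma sum_length_attained:
  assumes "set xs \<subseteq> S" "sum_list xs = \<gamma>"
  obtains ys where "length ys = sum_length S \<gamma>" "set ys \<subseteq> S" "sum_list ys = \<gamma>"
  using LeastI[of "\<lambda>r. \<exists>xs. length xs = r \<and> set xs \<subseteq> S \<and> sum_list xs = \<gamma>" "length xs"] assms
  unfolding sum_length_def by blast

lemma sum_length_mono:
  assumes "finite S" "S \<subseteq> T" "\<gamma> \<in> nat_span S"
  shows "sum_length T \<gamma> \<le> sum_length S \<gamma>"
proof -
  obtain xs where "set xs \<subseteq> S" "sum_list xs = \<gamma>"
    using nat_span_imp_sum_list assms by blast
  then obtain ys where "length ys = sum_length S \<gamma>" "set ys \<subseteq> S" "sum_list ys = \<gamma>"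
    by (rule sum_length_attained)
  then show ?thesis
    using sum_length_le[of ys T \<gamma>] assms(2) by auto
qed

lemma sum_list_nonpos_neg:
  fixes xs :: "real list"
  assumes "\<And>x. x \<in> set xs \<Longrightarrow> x \<le> 0" "y \<in> set xs" "y < 0"
  shows "sum_list xs < 0"
proof -
  have "sum_list (remove1 y xs) \<le> 0"
    using assms(1) by (intro sum_list_nonpos) (meson notin_set_remove1)
  then show ?thesis
    using sum_list_map_remove1[of y xs "\<lambda>x. x"] assms(2,3) by simp
qed

text \<open>Among the ways to write \<open>\<gamma>\<close> with a given number of summands from \<open>\<Phi> \<union> {0}\<close>, the one with
  the smallest sum of squares \<open>(t \<bullet> x)\<^sup>2\<close> has no negative summand.\<close>

lemma sum_length_eq_if_exchange:
  fixes \<Phi> :: "'a::euclidean_space set"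
  assumes fin: "finite \<Phi>" and t: "\<forall>\<alpha>\<in>\<Phi>. t \<bullet> \<alpha> \<noteq> 0" and P: "P = {\<alpha>\<in>\<Phi>. t \<bullet> \<alpha> > 0}"
    and exchange: "\<And>\<beta>. \<beta> \<in> \<Phi> \<Longrightarrow> t \<bullet> \<beta> < 0 \<Longrightarrow>
      \<exists>\<phi>::'a \<Rightarrow> real. linear \<phi> \<and> (\<forall>\<alpha>\<in>P. \<phi> \<alpha> \<ge> 0) \<and> \<phi> \<beta> < 0 \<and>
        (\<forall>\<delta>\<in>\<Phi>. \<phi> \<delta> > 0 \<longrightarrow> (\<exists>\<beta>'\<in>insert 0 \<Phi>. \<exists>\<delta>'\<in>insert 0 \<Phi>. \<beta> + \<delta> = \<beta>' + \<delta>' \<and>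
          (t \<bullet> \<beta>')\<^sup>2 + (t \<bullet> \<delta>')\<^sup>2 < (t \<bullet> \<beta>)\<^sup>2 + (t \<bullet> \<delta>)\<^sup>2))"
    and \<gamma>: "\<gamma> \<in> nat_span P"
  shows "sum_length P \<gamma> = sum_length \<Phi> \<gamma>"
proof (rule antisym)
  have "finite P" "P \<subseteq> \<Phi>"
    using fin P by auto
  then show "sum_length \<Phi> \<gamma> \<le> sum_length P \<gamma>"
    using \<gamma> by (intro sum_length_mono)
  obtain xs where "set xs \<subseteq> P" "sum_list xs = \<gamma>"
    using nat_span_imp_sum_list[OF \<open>finite P\<close> \<gamma>] by blast
  then obtain ys where ys: "length ys = sum_length \<Phi> \<gamma>" "set ys \<subseteq> \<Phi>" "sum_list ys = \<gamma>"
    using sum_length_attained[of xs \<Phi> \<gamma>] \<open>P \<subseteq> \<Phi>\<close> by blast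
  \<comment> \<open>The length is fixed and the summands come from a finite set, so a minimiser of
    \<open>q\<close> exists. Including 0 keeps \<open>L\<close> closed under exchanges that cancel a
    summand.\<close>
  define L where "L = {zs. set zs \<subseteq> insert 0 \<Phi> \<and> length zs = length ys \<and> sum_list zs = \<gamma>}"
  define q where "q zs = (\<Sum>z\<leftarrow>zs. (t \<bullet> z)\<^sup>2)" for zs :: "'a list"
  have "finite L"
    using finite_lists_length_eq[of "insert 0 \<Phi>" "length ys"] fin
    by (rule_tac finite_subset[rotated]) (auto simp: L_def)
  moreover have "ys \<in> L"
    using ys by (auto simp: L_def)
  ultimately obtain zs where zs: "zs \<in> L" and min: "\<And>zs'. zs' \<in> L \<Longrightarrow> \<not> q zs' < q zs"
    using ex_min_if_finite[of "q ` L"] by auto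
  have sumzs: "sum_list zs = \<gamma>" and setzs: "set zs \<subseteq> insert 0 \<Phi>" and lenzs: "length zs = length ys"
    using zs by (auto simp: L_def)
  have nonneg: "t \<bullet> \<beta> \<ge> 0" if "\<beta> \<in> set zs" for \<beta>
  proof (rule ccontr)
    assume "\<not> t \<bullet> \<beta> \<ge> 0"
    then have neg: "t \<bullet> \<beta> < 0" by simp
    then have "\<beta> \<in> \<Phi>"
      using setzs that by auto
    then obtain \<phi> :: "'a \<Rightarrow> real" where lin: "linear \<phi>" and "\<forall>\<alpha>\<in>P. \<phi> \<alpha> \<ge> 0" and "\<phi> \<beta> < 0"
      and ex: "\<And>\<delta>. \<delta> \<in> \<Phi> \<Longrightarrow> \<phi> \<delta> > 0 \<Longrightarrow> \<exists>\<beta>'\<in>insert 0 \<Phi>. \<exists>\<delta>'\<in>insert 0 \<Phi>. \<beta> + \<delta> = \<beta>' + \<delta>' \<and>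
          (t \<bullet> \<beta>')\<^sup>2 + (t \<bullet> \<delta>')\<^sup>2 < (t \<bullet> \<beta>)\<^sup>2 + (t \<bullet> \<delta>)\<^sup>2"
      using exchange[OF _ neg] by blast
    have "\<phi> (sum_list us) = sum_list (map \<phi> us)" for us
      by (induction us) (simp_all add: linear_0[OF lin] linear_add[OF lin])
    moreover have "\<phi> \<gamma> \<ge> 0"
      using linear_nonneg_nat_span[OF lin _ \<gamma>] \<open>\<forall>\<alpha>\<in>P. \<phi> \<alpha> \<ge> 0\<close> by blast
    ultimately have "sum_list (map \<phi> zs) \<ge> 0"
      using sumzs by auto
    \<comment> \<open>The total of \<open>\<phi>\<close> over the summands is
      \<open>\<phi> \<gamma>\<close>, which is nonnegative, so the negative share of \<beta> must be
      compensated by another summand.\<close>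
    have "\<exists>\<delta>\<in>set zs. \<phi> \<delta> > 0"
    proof (rule ccontr)
      assume "\<not> (\<exists>\<delta>\<in>set zs. \<phi> \<delta> > 0)"
      then have "sum_list (map \<phi> zs) < 0"
        using that \<open>\<phi> \<beta> < 0\<close> by (intro sum_list_nonpos_neg[of _ "\<phi> \<beta>"]) (auto simp: not_less)
      then show False
        using \<open>sum_list (map \<phi> zs) \<ge> 0\<close> by simp
    qed
    then obtain \<delta> where \<delta>: "\<delta> \<in> set zs" "\<phi> \<delta> > 0" ..
    then have "\<delta> \<in> \<Phi>"
      using setzs linear_0[OF lin] by auto
    then obtain \<beta>' \<delta>' where new: "\<beta>' \<in> insert 0 \<Phi>" "\<delta>' \<in> insert 0 \<Phi>" "\<beta> + \<delta> = \<beta>' + \<delta>'"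
      "(t \<bullet> \<beta>')\<^sup>2 + (t \<bullet> \<delta>')\<^sup>2 < (t \<bullet> \<beta>)\<^sup>2 + (t \<bullet> \<delta>)\<^sup>2"
      using ex \<delta>(2) by blast
    have "\<delta> \<noteq> \<beta>"
      using \<delta> \<open>\<phi> \<beta> < 0\<close> by auto
    define us where "us = remove1 \<delta> (remove1 \<beta> zs)"
    have "\<delta> \<in> set (remove1 \<beta> zs)"
      using \<delta> \<open>\<delta> \<noteq> \<beta>\<close> by simp
    have split: "sum_list (map f zs) = f \<beta> + f \<delta> + sum_list (map f us)"
      for f :: "'a \<Rightarrow> 'b::ab_group_add"
      using sum_list_map_remove1[OF that, of f]
        sum_list_map_remove1[OF \<open>\<delta> \<in> set (remove1 \<beta> zs)\<close>, of f]
      by (simp add: us_def algebra_simps)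
    \<comment> \<open>Guards the truncated subtraction in the length after two removals.\<close>
    have "length zs \<ge> 2"
      using that \<delta>(1) \<open>\<delta> \<noteq> \<beta>\<close> by (cases zs; cases "tl zs") auto
    then have "length (\<beta>' # \<delta>' # us) = length zs"
      using that \<open>\<delta> \<in> set (remove1 \<beta> zs)\<close> by (simp add: us_def length_remove1)
    moreover have "set us \<subseteq> set zs"
      unfolding us_def by (meson notin_set_remove1 subsetI)
    moreover have "sum_list (\<beta>' # \<delta>' # us) = \<gamma>"
      using split[of "\<lambda>x. x"] new(3) sumzs by (simp add: add.assoc[symmetric])
    ultimately have "\<beta>' # \<delta>' # us \<in> L"
      using new(1,2) setzs lenzs by (auto simp: L_def)
    moreover have "q (\<beta>' # \<delta>' # us) < q zs"
      using new(4) split[of "\<lambda>z. (t \<bullet> z)\<^sup>2"] by (simp add: q_def)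
    ultimately show False
      using min by blast
  qed
  \<comment> \<open>Deleting the zeros leaves the sum unchanged and can only shorten the list, which
    is enough for the upper bound.\<close>
  define ps where "ps = filter (\<lambda>z. z \<noteq> 0) zs"
  have "set ps \<subseteq> P"
  proof
    fix z assume "z \<in> set ps"
    then have "z \<in> \<Phi>" "t \<bullet> z \<ge> 0"
      using setzs nonneg by (auto simp: ps_def)
    then show "z \<in> P"
      using t P by (simp add: order_less_le)
  qed
  moreover have "sum_list ps = \<gamma>"
    using sum_list_map_filter[of zs "\<lambda>z. z \<noteq> 0" "\<lambda>z. z"] sumzs by (simp add: ps_def)
  ultimately have "sum_length P \<gamma> \<le> length ps"
    by (rule sum_length_le)
  also have "\<dots> \<le> sum_length \<Phi> \<gamma>"
    using length_filter_le[of "\<lambda>z. z \<noteq> 0" zs] ys(1) lenzs by (simp add: ps_def)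
  finally show "sum_length P \<gamma> \<le> sum_length \<Phi> \<gamma>" .
qed

text \<open>The two sides differ by 2 (x' - x) (y - y'). The variables stand for the
  \<open>t\<close>-values of the endpoints: the summand x - y goes down from y, and x' - y' passes
  upwards through y.\<close>

lemma swap_decreases_squares:
  fixes x y x' y' :: real
  assumes "x < y" "y \<le> x'" "y' < y"
  shows "(x - y')\<^sup>2 + (x' - y)\<^sup>2 < (x - y)\<^sup>2 + (x' - y')\<^sup>2"
proof -
  have "(x' - x) * (y - y') > 0"
    using assms by simp
  then show ?thesis
    by (simp add: power2_eq_square algebra_simps)
qed

text \<open>In both types the roots are the differences of distinct elements of a set \<open>X\<close> of weights.
  In type \<open>A\<close> these are \<open>l + 1\<close> affinely independent vectors, in type \<open>C\<close> a basis together with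
  its negatives.\<close>

lemma sum_length_eq_if_affine_weights:
  fixes \<Phi> :: "'a::euclidean_space set"
  assumes fin: "finite \<Phi>" and pos: "positive_subsystem \<Phi> P"
    and X: "insert 0 \<Phi> = {x - y |x y. x \<in> X \<and> y \<in> X}"
    and extend: "\<And>f::'a \<Rightarrow> real. \<exists>\<phi>. linear \<phi> \<and> (\<forall>x\<in>X. \<forall>y\<in>X. \<phi> (x - y) = f x - f y)"
    and \<gamma>: "\<gamma> \<in> nat_span P"
  shows "sum_length P \<gamma> = sum_length \<Phi> \<gamma>"
proof -
  obtain t where t: "\<forall>\<alpha>\<in>\<Phi>. t \<bullet> \<alpha> \<noteq> 0" and P: "P = {\<alpha>\<in>\<Phi>. t \<bullet> \<alpha> > 0}"
    using pos unfolding positive_subsystem_def by blast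
  have diff: "\<exists>x\<in>X. \<exists>y\<in>X. \<alpha> = x - y" if "\<alpha> \<in> \<Phi>" for \<alpha>
    using that X by blast
  have pos_diff: "\<exists>v\<in>X. \<exists>w\<in>X. \<alpha> = v - w \<and> t \<bullet> w < t \<bullet> v" if "\<alpha> \<in> P" for \<alpha>
  proof -
    have "\<alpha> \<in> \<Phi>" "t \<bullet> \<alpha> > 0"
      using that P by auto
    moreover obtain v w where "v \<in> X" "w \<in> X" "\<alpha> = v - w"
      using diff[OF \<open>\<alpha> \<in> \<Phi>\<close>] by blast
    ultimately show ?thesis
      by (intro bexI[of _ v] bexI[of _ w]) (auto simp: inner_diff_right)
  qed
  show ?thesis
  proof (rule sum_length_eq_if_exchange[OF fin t P _ \<gamma>])
    fix \<beta> assume "\<beta> \<in> \<Phi>" "t \<bullet> \<beta> < 0"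
    obtain x y where xy: "x \<in> X" "y \<in> X" "\<beta> = x - y"
      using diff[OF \<open>\<beta> \<in> \<Phi>\<close>] by blast
    then have less: "t \<bullet> x < t \<bullet> y"
      using \<open>t \<bullet> \<beta> < 0\<close> by (simp add: inner_diff_right)
    \<comment> \<open>A step at the level of y. On differences, \<open>\<phi>\<close> is 1 if the
      level is passed upwards, -1 if it is passed downwards and 0 otherwise.\<close>
    define f where "f w = (if t \<bullet> y \<le> t \<bullet> w then 1 else 0 :: real)" for w
    obtain \<phi> :: "'a \<Rightarrow> real" where lin: "linear \<phi>"
      and \<phi>: "\<And>v w. v \<in> X \<Longrightarrow> w \<in> X \<Longrightarrow> \<phi> (v - w) = f v - f w"
      using extend[of f] by blast
    have "\<phi> \<alpha> \<ge> 0" if "\<alpha> \<in> P" for \<alpha>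
    proof -
      obtain v w where "v \<in> X" "w \<in> X" "\<alpha> = v - w" "t \<bullet> w < t \<bullet> v"
        using pos_diff[OF \<open>\<alpha> \<in> P\<close>] by blast
      then show ?thesis
        using \<phi> by (auto simp: f_def)
    qed
    moreover have "\<phi> \<beta> < 0"
      using xy less \<phi> by (auto simp: f_def)
    moreover have "\<exists>\<beta>'\<in>insert 0 \<Phi>. \<exists>\<delta>'\<in>insert 0 \<Phi>. \<beta> + \<delta> = \<beta>' + \<delta>' \<and>
        (t \<bullet> \<beta>')\<^sup>2 + (t \<bullet> \<delta>')\<^sup>2 < (t \<bullet> \<beta>)\<^sup>2 + (t \<bullet> \<delta>)\<^sup>2"
      if "\<delta> \<in> \<Phi>" "\<phi> \<delta> > 0" for \<delta>
    proof -
      obtain v w where vw: "v \<in> X" "w \<in> X" "\<delta> = v - w"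
        using diff \<open>\<delta> \<in> \<Phi>\<close> by blast
      then have "f v > f w"
        using \<phi> that(2) by auto
      then have "t \<bullet> y \<le> t \<bullet> v" "t \<bullet> w < t \<bullet> y"
        by (auto simp: f_def split: if_splits)
      then have "(t \<bullet> (x - w))\<^sup>2 + (t \<bullet> (v - y))\<^sup>2 < (t \<bullet> \<beta>)\<^sup>2 + (t \<bullet> \<delta>)\<^sup>2"
        using swap_decreases_squares[OF less] xy(3) vw(3) by (simp add: inner_diff_right)
      moreover have "x - w \<in> insert 0 \<Phi>" "v - y \<in> insert 0 \<Phi>"
        unfolding X using xy vw by blast+
      moreover have "\<beta> + \<delta> = (x - w) + (v - y)"
        using xy vw by simp
      ultimately show ?thesis
        by blast
    qed
    ultimately show "\<exists>\<phi>::'a \<Rightarrow> real. linear \<phi> \<and> (\<forall>\<alpha>\<in>P. \<phi> \<alpha> \<ge> 0) \<and> \<phi> \<beta> < 0 \<and>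
        (\<forall>\<delta>\<in>\<Phi>. \<phi> \<delta> > 0 \<longrightarrow> (\<exists>\<beta>'\<in>insert 0 \<Phi>. \<exists>\<delta>'\<in>insert 0 \<Phi>. \<beta> + \<delta> = \<beta>' + \<delta>' \<and>
          (t \<bullet> \<beta>')\<^sup>2 + (t \<bullet> \<delta>')\<^sup>2 < (t \<bullet> \<beta>)\<^sup>2 + (t \<bullet> \<delta>)\<^sup>2))"
      using lin by blast
  qed
qed

text \<open>A linear functional is odd on a symmetric set of weights, so a single step cannot be
  extended; steps at two opposite levels are combined. In return every difference has a second form,
  x - y = (-y) - (-x), which moves a passage through the lower level to the upper one.\<close>

lemma sum_length_eq_if_symmetric_weights:
  fixes \<Phi> :: "'a::euclidean_space set"
  assumes fin: "finite \<Phi>" and pos: "positive_subsystem \<Phi> P"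
    and X: "insert 0 \<Phi> = {x - y |x y. x \<in> X \<and> y \<in> X}" and sym: "\<And>x. x \<in> X \<Longrightarrow> - x \<in> X"
    and extend: "\<And>f::'a \<Rightarrow> real. (\<And>v. f (- v) = - f v) \<Longrightarrow> \<exists>\<phi>. linear \<phi> \<and> (\<forall>x\<in>X. \<phi> x = f x)"
    and \<gamma>: "\<gamma> \<in> nat_span P"
  shows "sum_length P \<gamma> = sum_length \<Phi> \<gamma>"
proof -
  obtain t where t: "\<forall>\<alpha>\<in>\<Phi>. t \<bullet> \<alpha> \<noteq> 0" and P: "P = {\<alpha>\<in>\<Phi>. t \<bullet> \<alpha> > 0}"
    using pos unfolding positive_subsystem_def by blast
  have diff: "\<exists>x\<in>X. \<exists>y\<in>X. \<alpha> = x - y" if "\<alpha> \<in> \<Phi>" for \<alpha>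
    using that X by blast
  have pos_diff: "\<exists>v\<in>X. \<exists>w\<in>X. \<alpha> = v - w \<and> t \<bullet> w < t \<bullet> v" if "\<alpha> \<in> P" for \<alpha>
  proof -
    have "\<alpha> \<in> \<Phi>" "t \<bullet> \<alpha> > 0"
      using that P by auto
    moreover obtain v w where "v \<in> X" "w \<in> X" "\<alpha> = v - w"
      using diff[OF \<open>\<alpha> \<in> \<Phi>\<close>] by blast
    ultimately show ?thesis
      by (intro bexI[of _ v] bexI[of _ w]) (auto simp: inner_diff_right)
  qed
  show ?thesis
  proof (rule sum_length_eq_if_exchange[OF fin t P _ \<gamma>])
    fix \<beta> assume "\<beta> \<in> \<Phi>" "t \<bullet> \<beta> < 0"
    obtain x' y' where xy': "x' \<in> X" "y' \<in> X" "\<beta> = x' - y'"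
      using diff[OF \<open>\<beta> \<in> \<Phi>\<close>] by blast
    then have less: "t \<bullet> x' < t \<bullet> y'"
      using \<open>t \<bullet> \<beta> < 0\<close> by (simp add: inner_diff_right)
    \<comment> \<open>If y' does not lie above 0, then x' lies strictly below 0, and the second form
      -y' - (-x') has the required positive upper end.\<close>
    obtain x y where xy: "x \<in> X" "y \<in> X" "\<beta> = x - y" "t \<bullet> x < t \<bullet> y" "t \<bullet> y > 0"
    proof (cases "t \<bullet> y' > 0")
      case True
      then show ?thesis using that[of x' y'] xy' less by blast
    next
      case False
      then show ?thesis
        using that[of "- y'" "- x'"] xy' less sym by simp
    qed
    \<comment> \<open>An odd nondecreasing step function with values -1, 0, 1. Because
      \<open>t \<bullet> y > 0\<close>, the lower step does not cancel the upper one at y, so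
      \<open>f y = 1\<close>.\<close>
    define f where "f w = (if t \<bullet> y \<le> t \<bullet> w then 1 else 0) - (if t \<bullet> w \<le> - (t \<bullet> y) then 1 else 0 :: real)"
      for w
    have "f (- w) = - f w" for w
      by (auto simp: f_def)
    then obtain \<phi> :: "'a \<Rightarrow> real" where lin: "linear \<phi>" and "\<And>v. v \<in> X \<Longrightarrow> \<phi> v = f v"
      using extend[of f] by blast
    then have \<phi>: "\<phi> (v - w) = f v - f w" if "v \<in> X" "w \<in> X" for v w
      using that by (simp add: linear_diff)
    have "\<phi> \<alpha> \<ge> 0" if "\<alpha> \<in> P" for \<alpha>
    proof -
      obtain v w where "v \<in> X" "w \<in> X" "\<alpha> = v - w" "t \<bullet> w < t \<bullet> v"
        using pos_diff[OF \<open>\<alpha> \<in> P\<close>] by blast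
      then show ?thesis
        using \<phi> by (auto simp: f_def)
    qed
    moreover have "\<phi> \<beta> < 0"
      using xy \<phi> by (auto simp: f_def)
    moreover have "\<exists>\<beta>'\<in>insert 0 \<Phi>. \<exists>\<delta>'\<in>insert 0 \<Phi>. \<beta> + \<delta> = \<beta>' + \<delta>' \<and>
        (t \<bullet> \<beta>')\<^sup>2 + (t \<bullet> \<delta>')\<^sup>2 < (t \<bullet> \<beta>)\<^sup>2 + (t \<bullet> \<delta>)\<^sup>2"
      if "\<delta> \<in> \<Phi>" "\<phi> \<delta> > 0" for \<delta>
    proof -
      obtain v' w' where vw': "v' \<in> X" "w' \<in> X" "\<delta> = v' - w'"
        using diff \<open>\<delta> \<in> \<Phi>\<close> by blast
      then have "f v' > f w'"
        using \<phi> that(2) by auto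
      \<comment> \<open>An increase of \<open>f\<close> is a passage through one of the two levels;
        if it is not the upper one, the negated and interchanged endpoints pass through the upper
        one.\<close>
      obtain v w where vw: "v \<in> X" "w \<in> X" "\<delta> = v - w" "t \<bullet> y \<le> t \<bullet> v" "t \<bullet> w < t \<bullet> y"
      proof (cases "t \<bullet> y \<le> t \<bullet> v' \<and> t \<bullet> w' < t \<bullet> y")
        case True
        then show ?thesis using that[of v' w'] vw' by blast
      next
        case False
        then have "t \<bullet> y \<le> t \<bullet> (- w')" "t \<bullet> (- v') < t \<bullet> y"
          using \<open>f v' > f w'\<close> xy(5) by (auto simp: f_def split: if_splits)
        then show ?thesis
          using that[of "- w'" "- v'"] vw' sym by simp
      qed
      then have "(t \<bullet> (x - w))\<^sup>2 + (t \<bullet> (v - y))\<^sup>2 < (t \<bullet> \<beta>)\<^sup>2 + (t \<bullet> \<delta>)\<^sup>2"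
        using swap_decreases_squares[OF xy(4)] xy(3) by (simp add: inner_diff_right)
      moreover have "x - w \<in> insert 0 \<Phi>" "v - y \<in> insert 0 \<Phi>"
        unfolding X using xy vw by blast+
      moreover have "\<beta> + \<delta> = (x - w) + (v - y)"
        using xy vw by simp
      ultimately show ?thesis
        by blast
    qed
    ultimately show "\<exists>\<phi>::'a \<Rightarrow> real. linear \<phi> \<and> (\<forall>\<alpha>\<in>P. \<phi> \<alpha> \<ge> 0) \<and> \<phi> \<beta> < 0 \<and>
        (\<forall>\<delta>\<in>\<Phi>. \<phi> \<delta> > 0 \<longrightarrow> (\<exists>\<beta>'\<in>insert 0 \<Phi>. \<exists>\<delta>'\<in>insert 0 \<Phi>. \<beta> + \<delta> = \<beta>' + \<delta>' \<and>
          (t \<bullet> \<beta>')\<^sup>2 + (t \<bullet> \<delta>')\<^sup>2 < (t \<bullet> \<beta>)\<^sup>2 + (t \<bullet> \<delta>)\<^sup>2))"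
      using lin by blast
  qed
qed

section \<open>Types A and C\<close>

context root_sys
begin

text \<open>The vectors \<open>e 0\<close>, ..., \<open>e l\<close> are the weights of the standard
  representation, realised in the l-dimensional space itself. The reflection in \<open>s i\<close>
  interchanges \<open>e (i - 1)\<close> and \<open>e i\<close> and fixes the others, so the roots
  are the differences of distinct weights.\<close>

lemma sum_length_eq_if_type_A:
  assumes "type_A \<Phi> l" and pos: "positive_subsystem \<Phi> P" and \<gamma>: "\<gamma> \<in> nat_span P"
  shows "sum_length P \<gamma> = sum_length \<Phi> \<gamma>"
proof -
  obtain s where inj: "inj_on s {1..l}" and base: "root_base \<Phi> (s ` {1..l})"
    and cartan: "\<And>i j. i \<in> {1..l} \<Longrightarrow> j \<in> {1..l} \<Longrightarrow> cartan_int (s i) (s j) = cartan_A i j"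
    using assms(1) unfolding type_A_def has_cartan_matrix_def by blast
  interpret root_sys_base \<Phi> "s ` {1..l}"
    using base by unfold_locales
  have extend: "\<exists>\<phi>. linear \<phi> \<and> (\<forall>i\<in>{1..l}. \<phi> (s i) = g i)" for g :: "nat \<Rightarrow> real"
    using linear_independent_extend[OF independent_base, of "\<lambda>b. g (inv_into {1..l} s b)"] inj
    by auto
  have nonzero: "s i \<noteq> 0" if "i \<in> {1..l}" for i
    using that root_nonzero simple_root by blast
  \<comment> \<open>The vector \<open>adjoint \<phi> 1\<close> represents \<open>\<phi>\<close> by
    the inner product. With these values it pairs to 1 with the coroot of \<open>s 1\<close> and to
    0 with the other simple coroots: it is the first fundamental weight, the highest weight
    \<open>e 0\<close>.\<close>
  obtain \<phi> :: "'a \<Rightarrow> real" where "linear \<phi>"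
    and \<phi>: "\<forall>i\<in>{1..l}. \<phi> (s i) = (if i = 1 then (s i \<bullet> s i) / 2 else 0)"
    using extend[of "\<lambda>i. if i = 1 then (s i \<bullet> s i) / 2 else 0"] by blast
  define e where "e j = adjoint \<phi> 1 - (\<Sum>i\<in>{1..j}. s i)" for j
  have e_Suc: "e (Suc j) = e j - s (Suc j)" for j
    by (simp add: e_def)
  have e_step: "e (i - 1) = e i + s i" if "i \<in> {1..l}" for i
    using that e_Suc[of "i - 1"] by simp
  have cartan_e: "cartan_int (e j) (s i) = (if j + 1 = i then 1 else if j = i then -1 else 0)"
    if "j \<le> l" "i \<in> {1..l}" for i j
    using that(1)
  proof (induction j)
    case 0
    have "e 0 \<bullet> s i = \<phi> (s i)"
      using adjoint_works[OF \<open>linear \<phi>\<close>, of "s i" 1] by (simp add: e_def inner_commute)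
    then show ?case
      using \<phi> that(2) nonzero[of i] by (auto simp: cartan_int_def)
  next
    case (Suc j)
    then show ?case
      using cartan[of "Suc j" i] that(2)
      by (auto simp: e_Suc cartan_int_diff cartan_A_def)
  qed
  have reflect_e: "reflection (s i) (e j) = (if j + 1 = i then e i else if j = i then e (i - 1) else e j)"
    if "j \<le> l" "i \<in> {1..l}" for i j
    using cartan_e[OF that] e_step[OF that(2)] e_Suc[of j] by (auto simp: reflection_eq_cartan_int)
  let ?X = "e ` {0..l}"
  have e_diff: "e i - e (i + Suc d) \<in> \<Phi>" if "i + Suc d \<le> l" for i d
    using that
  proof (induction d)
    case 0
    then show ?case
      using simple_root[of "s (i + 1)"] by (simp add: e_Suc)
  next
    case (Suc d)
    let ?k = "i + Suc (Suc d)"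
    \<comment> \<open>The reflection in \<open>s ?k\<close> moves the second endpoint one place
      further and fixes \<open>e i\<close>.\<close>
    have "e i - e ?k = reflection (s ?k) (e i - e (i + Suc d))"
      using Suc.prems by (simp add: reflection_diff reflect_e)
    then show ?case
      using Suc reflection_root simple_root[of "s ?k"] by simp
  qed
  have roots: "e i - e j \<in> insert 0 \<Phi>" if "i \<le> l" "j \<le> l" for i j
  proof (cases i j rule: linorder_cases)
    case less
    then show ?thesis
      using e_diff[of i "j - i - 1"] that by simp
  next
    case greater
    then show ?thesis
      using uminus_root[OF e_diff[of j "i - j - 1"]] that by simp
  qed simp
  have "insert 0 \<Phi> = {x - y |x y. x \<in> ?X \<and> y \<in> ?X}"
  proof (rule equalityI; rule subsetI)
    fix \<beta> assume "\<beta> \<in> insert 0 \<Phi>"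
    moreover have "\<exists>x\<in>?X. \<exists>y\<in>?X. \<beta> = x - y" if "\<beta> \<in> \<Phi>"
    proof (rule roots_subset_differences[OF _ _ that])
      fix \<alpha> assume "\<alpha> \<in> s ` {1..l}"
      then obtain i where i: "i \<in> {1..l}" "\<alpha> = s i" by blast
      then have "e (i - 1) \<in> ?X" "e i \<in> ?X"
        by auto
      moreover have "\<alpha> = e (i - 1) - e i"
        using e_step[OF i(1)] i(2) by simp
      ultimately show "\<exists>x\<in>?X. \<exists>y\<in>?X. \<alpha> = x - y"
        by (intro bexI[of _ "e (i - 1)"] bexI[of _ "e i"])
    next
      fix \<alpha> x assume "\<alpha> \<in> s ` {1..l}" "x \<in> ?X"
      then show "reflection \<alpha> x \<in> ?X"
        by (auto simp: reflect_e)
    qed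
    moreover have "0 = e 0 - e 0" "e 0 \<in> ?X" by auto
    ultimately show "\<beta> \<in> {x - y |x y. x \<in> ?X \<and> y \<in> ?X}"
      by blast
  next
    fix \<beta> assume "\<beta> \<in> {x - y |x y. x \<in> ?X \<and> y \<in> ?X}"
    then obtain i j where "i \<in> {0..l}" "j \<in> {0..l}" "\<beta> = e i - e j"
      by blast
    then show "\<beta> \<in> insert 0 \<Phi>"
      using roots[of i j] by simp
  qed
  then show ?thesis
  proof (rule sum_length_eq_if_affine_weights[OF finite_roots pos _ _ \<gamma>])
    fix f :: "'a \<Rightarrow> real"
    obtain \<psi> :: "'a \<Rightarrow> real" where lin: "linear \<psi>"
      and \<psi>: "\<forall>i\<in>{1..l}. \<psi> (s i) = f (e (i - 1)) - f (e i)"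
      using extend[of "\<lambda>i. f (e (i - 1)) - f (e i)"] by blast
    \<comment> \<open>There are l + 1 weights in dimension l, so \<open>f\<close> can be matched
      only up to a constant; it cancels in differences.\<close>
    define c where "c = \<psi> (e 0) - f (e 0)"
    have "\<psi> (e j) = c + f (e j)" if "j \<le> l" for j
      using that
    proof (induction j)
      case (Suc j)
      then show ?case
        using \<psi>[rule_format, of "Suc j"] by (simp add: e_Suc[of j] linear_diff[OF lin])
    qed (simp add: c_def)
    then have "\<forall>x\<in>?X. \<forall>y\<in>?X. \<psi> (x - y) = f x - f y"
      by (auto simp: linear_diff[OF lin])
    with lin show "\<exists>\<psi>. linear \<psi> \<and> (\<forall>x\<in>?X. \<forall>y\<in>?X. \<psi> (x - y) = f x - f y)"
      by blast
  qed
qed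

text \<open>The \<open>e j\<close> are the standard coordinates in which the roots are the sums and
  differences of two distinct \<open>e i\<close>, the doubles of the \<open>e i\<close>, and their
  negatives. Simple reflections permute neighbouring \<open>e j\<close>, and the last one changes
  the sign of \<open>e l\<close>; the double of \<open>e i\<close> is the difference of the weights
  \<open>e i\<close> and \<open>- e i\<close>.\<close>

lemma sum_length_eq_if_type_C:
  assumes "type_C \<Phi> l" and pos: "positive_subsystem \<Phi> P" and \<gamma>: "\<gamma> \<in> nat_span P"
  shows "sum_length P \<gamma> = sum_length \<Phi> \<gamma>"
proof -
  obtain s where inj: "inj_on s {1..l}" and base: "root_base \<Phi> (s ` {1..l})"
    and cartan: "\<And>i j. i \<in> {1..l} \<Longrightarrow> j \<in> {1..l} \<Longrightarrow> cartan_int (s i) (s j) = cartan_C l i j"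
    and "l \<ge> 2"
    using assms(1) unfolding type_C_def has_cartan_matrix_def by blast
  interpret root_sys_base \<Phi> "s ` {1..l}"
    using base by unfold_locales
  have extend: "\<exists>\<phi>. linear \<phi> \<and> (\<forall>i\<in>{1..l}. \<phi> (s i) = g i)" for g :: "nat \<Rightarrow> real"
    using linear_independent_extend[OF independent_base, of "\<lambda>b. g (inv_into {1..l} s b)"] inj
    by auto
  have simple: "s i \<in> \<Phi>" if "i \<in> {1..l}" for i
    using that simple_root by blast
  define e where "e j = (\<Sum>i\<in>{j..<l}. s i) + (1/2) *\<^sub>R s l" for j
  have e_last: "e l = (1/2) *\<^sub>R s l"
    by (simp add: e_def)
  have e_step: "e j = s j + e (Suc j)" if "j < l" for j
    using that by (simp add: e_def sum.atLeast_Suc_lessThan)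
  \<comment> \<open>The entry -2 in the row of the long root is halved in \<open>e l\<close>, so the
    formula remains uniform up to j = l.\<close>
  have cartan_e: "cartan_int (e j) (s i) = (if j = i then 1 else if j = i + 1 then -1 else 0)"
    if "j \<in> {1..l}" "i \<in> {1..l}" for i j
  proof -
    have "j \<le> l" "1 \<le> j" using that by auto
    then show ?thesis
    proof (induction j rule: inc_induct)
      case base
      then show ?case
        using cartan[of l i] that(2) by (auto simp: e_last cartan_int_scaleR cartan_C_def cartan_A_def)
    next
      case (step j)
      then have "cartan_int (e j) (s i) = cartan_C l j i + (if Suc j = i then 1 else if Suc j = i + 1 then -1 else 0)"
        using cartan[of j i] that(2) by (simp add: e_step cartan_int_add)
      then show ?case
        using step.hyps by (auto simp: cartan_C_def cartan_A_def)
    qed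
  qed
  have reflect_e: "reflection (s i) (e j) = (if j = i then e (i + 1) else if j = i + 1 then e i else e j)"
    if "j \<in> {1..l}" "i \<in> {1..<l}" for i j
    using cartan_e[of j i] e_step[of i] that by (auto simp: reflection_eq_cartan_int)
  have reflect_last: "reflection (s l) (e j) = (if j = l then - e l else e j)"
    if "j \<in> {1..l}" for j
  proof (cases "j = l")
    case True
    then have "reflection (s l) (e j) = e l - 2 *\<^sub>R e l"
      using cartan_e[of l l] that by (simp add: reflection_eq_cartan_int) (simp add: e_last)
    then show ?thesis
      using True by (simp add: scaleR_2)
  next
    case False
    then show ?thesis
      using cartan_e[of j l] that by (simp add: reflection_eq_cartan_int)
  qed
  have diff_e: "e i - e j \<in> \<Phi>" if "1 \<le> i" "i < j" "j \<le> l" for i j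
    using Suc_leI[OF that(2)] that(3)
  proof (induction j rule: dec_induct)
    case base
    then show ?case
      using simple[of i] that(1) e_step[of i] by simp
  next
    case (step j)
    then have "e i - e (Suc j) = reflection (s j) (e i - e j)"
      using that(1) by (simp add: reflection_diff reflect_e)
    then show ?case
      using step that(1) reflection_root simple[of j] by simp
  qed
  \<comment> \<open>The sign change of \<open>e l\<close> produces the case j = l from a difference;
    the reflections in \<open>s j\<close> then carry the second index downwards.\<close>
  have sum_e: "e i + e j \<in> \<Phi>" if "1 \<le> i" "i < j" "j \<le> l" for i j
    using that(3,2)
  proof (induction j rule: inc_induct)
    case base
    then have "e i + e l = reflection (s l) (e i - e l)"
      using that(1) by (simp add: reflection_diff reflect_last)
    then show ?case
      using base that(1) diff_e reflection_root simple[of l] by simp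
  next
    case (step j)
    then have "e i + e j = reflection (s j) (e i + e (Suc j))"
      using that(1) by (simp add: reflection_add reflect_e)
    then show ?case
      using step that(1) reflection_root simple[of j] by simp
  qed
  have double_e: "e j + e j \<in> \<Phi>" if "1 \<le> j" "j \<le> l" for j
    using that(2,1)
  proof (induction j rule: inc_induct)
    case base
    then show ?case
      using simple[of l] by (simp add: e_last flip: scaleR_left.add)
  next
    case (step j)
    then have "e j + e j = reflection (s j) (e (Suc j) + e (Suc j))"
      by (simp add: reflection_add reflect_e)
    then show ?case
      using step reflection_root simple[of j] by simp
  qed
  have sum_root: "e i + e j \<in> \<Phi>" if "i \<in> {1..l}" "j \<in> {1..l}" for i j
    using that sum_e[of i j] sum_e[of j i] double_e[of i]
    by (cases i j rule: linorder_cases) (auto simp: add.commute)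
  have diff_root': "e i - e j \<in> insert 0 \<Phi>" if "i \<in> {1..l}" "j \<in> {1..l}" for i j
    using that diff_e[of i j] uminus_root[OF diff_e[of j i]]
    by (cases i j rule: linorder_cases) auto
  let ?X = "e ` {1..l} \<union> uminus ` e ` {1..l}"
  have sym: "- x \<in> ?X" if "x \<in> ?X" for x
    using that by force
  have "insert 0 \<Phi> = {x - y |x y. x \<in> ?X \<and> y \<in> ?X}"
  proof (rule equalityI; rule subsetI)
    fix \<beta> assume "\<beta> \<in> insert 0 \<Phi>"
    moreover have "\<exists>x\<in>?X. \<exists>y\<in>?X. \<beta> = x - y" if "\<beta> \<in> \<Phi>"
    proof (rule roots_subset_differences[OF _ _ that])
      fix \<alpha> assume "\<alpha> \<in> s ` {1..l}"
      then obtain i where i: "i \<in> {1..l}" "\<alpha> = s i" by blast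
      show "\<exists>x\<in>?X. \<exists>y\<in>?X. \<alpha> = x - y"
      proof (cases "i = l")
        case True
        then have "\<alpha> = e l - (- e l)"
          using i by (simp add: e_last flip: scaleR_left.add)
        moreover have "e l \<in> ?X"
          using \<open>l \<ge> 2\<close> by simp
        ultimately show ?thesis
          using sym by blast
      next
        case False
        then have "e i \<in> ?X" "e (Suc i) \<in> ?X"
          using i by auto
        moreover have "\<alpha> = e i - e (Suc i)"
          using False i e_step[of i] by simp
        ultimately show ?thesis
          by blast
      qed
    next
      fix \<alpha> x assume "\<alpha> \<in> s ` {1..l}" "x \<in> ?X"
      then obtain i where i: "i \<in> {1..l}" "\<alpha> = s i" by blast
      have *: "reflection \<alpha> (e j) \<in> ?X" if "j \<in> {1..l}" for j
        using i that sym by (cases "i = l") (auto simp: reflect_e reflect_last)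
      have "reflection \<alpha> (- v) = - reflection \<alpha> v" for v
        using reflection_scaleR[of \<alpha> "- 1" v] by simp
      moreover obtain j where "j \<in> {1..l}" "x = e j \<or> x = - e j"
        using \<open>x \<in> ?X\<close> by blast
      ultimately show "reflection \<alpha> x \<in> ?X"
        using *[of j] sym[OF *[of j]] by (elim disjE) (simp_all only:)
    qed
    moreover have "0 = e l - e l" "e l \<in> ?X" using \<open>l \<ge> 2\<close> by auto
    ultimately show "\<beta> \<in> {x - y |x y. x \<in> ?X \<and> y \<in> ?X}"
      by blast
  next
    fix \<beta> assume "\<beta> \<in> {x - y |x y. x \<in> ?X \<and> y \<in> ?X}"
    then obtain x y where xy: "x \<in> ?X" "y \<in> ?X" "\<beta> = x - y" by blast
    obtain i j where ij: "i \<in> {1..l}" "x = e i \<or> x = - e i" "j \<in> {1..l}" "y = e j \<or> y = - e j"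
      using xy(1,2) by blast
    have "- e i - e j \<in> \<Phi>"
      using uminus_root[OF sum_root[OF ij(1,3)]] by simp
    then show "\<beta> \<in> insert 0 \<Phi>"
      using ij(2,4) sum_root[OF ij(1,3)] diff_root'[OF ij(1,3)] diff_root'[OF ij(3,1)]
      unfolding xy(3) by (elim disjE) (simp_all only: diff_minus_eq_add minus_diff_minus
          minus_add_distrib insert_iff simp_thms uminus_add_conv_diff)
  qed
  then show ?thesis
  proof (rule sum_length_eq_if_symmetric_weights[OF finite_roots pos _ sym _ \<gamma>])
    fix f :: "'a \<Rightarrow> real" assume odd: "\<And>v. f (- v) = - f v"
    \<comment> \<open>The prescribed values express the simple roots through the \<open>e j\<close>,
      with \<open>s l\<close> equal to twice \<open>e l\<close>. Here \<open>f\<close> is matched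
      exactly on the \<open>e j\<close>, and oddness settles their negatives.\<close>
    obtain \<psi> :: "'a \<Rightarrow> real" where lin: "linear \<psi>"
      and \<psi>: "\<forall>i\<in>{1..l}. \<psi> (s i) = (if i = l then 2 * f (e l) else f (e i) - f (e (Suc i)))"
      using extend[of "\<lambda>i. if i = l then 2 * f (e l) else f (e i) - f (e (Suc i))"] by blast
    have "\<psi> (e j) = f (e j)" if "1 \<le> j" "j \<le> l" for j
      using that(2,1)
    proof (induction j rule: inc_induct)
      case base
      then show ?case
        using \<psi>[rule_format, of l] by (simp add: e_last linear_cmul[OF lin])
    next
      case (step j)
      then show ?case
        using \<psi>[rule_format, of j] e_step[of j] by (simp add: linear_add[OF lin])
    qed
    then have "\<forall>x\<in>?X. \<psi> x = f x"
      by (auto simp: linear_neg[OF lin] odd)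
    with lin show "\<exists>\<psi>. linear \<psi> \<and> (\<forall>x\<in>?X. \<psi> x = f x)"
      by blast
  qed
qed

end

section \<open>Positive subsystems and simple roots\<close>

text \<open>Separating positive and negative coefficients turns a linear relation into p = n with
  nonnegative combinations of disjoint supports. Obtuseness gives p \<bullet> n \<le> 0, so both
  vanish, and pairing with \<open>t\<close> forces every coefficient to be 0.\<close>

lemma obtuse_imp_independent:
  fixes \<Delta> :: "'a::euclidean_space set"
  assumes fin: "finite \<Delta>" and pos: "\<And>\<alpha>. \<alpha> \<in> \<Delta> \<Longrightarrow> t \<bullet> \<alpha> > 0"
    and obtuse: "\<And>\<alpha> \<beta>. \<alpha> \<in> \<Delta> \<Longrightarrow> \<beta> \<in> \<Delta> \<Longrightarrow> \<alpha> \<noteq> \<beta> \<Longrightarrow> \<alpha> \<bullet> \<beta> \<le> 0"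
  shows "independent \<Delta>"
proof
  assume "dependent \<Delta>"
  then obtain u where u: "\<exists>v\<in>\<Delta>. u v \<noteq> 0" "(\<Sum>v\<in>\<Delta>. u v *\<^sub>R v) = 0"
    using dependent_finite[OF fin] by blast
  define p where "p = (\<Sum>v\<in>\<Delta>. max (u v) 0 *\<^sub>R v)"
  define n where "n = (\<Sum>v\<in>\<Delta>. max (- u v) 0 *\<^sub>R v)"
  have "p - n = (\<Sum>v\<in>\<Delta>. u v *\<^sub>R v)"
    unfolding p_def n_def sum_subtractf[symmetric]
    by (rule sum.cong) (auto simp: max_def simp flip: scaleR_left_diff_distrib)
  then have "p = n"
    using u(2) by simp
  have "p \<bullet> n = (\<Sum>v\<in>\<Delta>. \<Sum>w\<in>\<Delta>. max (u v) 0 * (max (- u w) 0 * (v \<bullet> w)))"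
    by (simp add: p_def n_def inner_sum_left inner_sum_right sum_distrib_left)
      (subst sum.swap, simp add: mult.assoc mult.left_commute)
  also have "\<dots> \<le> 0"
  proof (intro sum_nonpos)
    fix v w assume vw: "v \<in> \<Delta>" "w \<in> \<Delta>"
    show "max (u v) 0 * (max (- u w) 0 * (v \<bullet> w)) \<le> 0"
    proof (cases "v = w")
      case True
      then show ?thesis by (auto simp: max_def)
    next
      case False
      then show ?thesis
        using obtuse[OF vw] by (intro mult_nonneg_nonpos) auto
    qed
  qed
  finally have "p \<bullet> p \<le> 0"
    using \<open>p = n\<close> by simp
  then have "p = 0"
    by (metis inner_gt_zero_iff not_le)
  have vanish: "c v = 0"
    if "(\<Sum>v\<in>\<Delta>. c v *\<^sub>R v) = 0" "\<And>v. c v \<ge> 0" "v \<in> \<Delta>" for c :: "'a \<Rightarrow> real" and v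
  proof -
    have "(\<Sum>v\<in>\<Delta>. c v * (t \<bullet> v)) = 0"
      using arg_cong[OF that(1), of "\<lambda>x. t \<bullet> x"] by (simp add: inner_sum_right)
    moreover have "c v * (t \<bullet> v) \<ge> 0" if "v \<in> \<Delta>" for v
      using \<open>c v \<ge> 0\<close> pos[OF that] by simp
    ultimately have "c v * (t \<bullet> v) = 0"
      using sum_nonneg_eq_0_iff[OF fin, of "\<lambda>v. c v * (t \<bullet> v)"] that(3) by simp
    then show ?thesis
      using pos[OF that(3)] by simp
  qed
  have "max (u v) 0 = 0" "max (- u v) 0 = 0" if "v \<in> \<Delta>" for v
    using vanish[of "\<lambda>v. max (u v) 0" v] vanish[of "\<lambda>v. max (- u v) 0" v] that
      \<open>p = 0\<close> \<open>p = n\<close> by (simp_all add: p_def n_def)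
  then show False
    using u(1) by (metis max.absorb_iff1 max.commute neg_le_0_iff_le order_antisym)
qed

context root_sys
begin

text \<open>The simple roots are the indecomposable positive roots. If two of them had a positive
  inner product, their difference would be a root, and whichever sign it had, one of the two would
  decompose.\<close>

lemma positive_subsystem_base:
  assumes "positive_subsystem \<Phi> P"
  obtains \<Delta> where "\<Delta> \<subseteq> P" "P \<subseteq> nat_span \<Delta>" "root_base \<Phi> \<Delta>"
    "\<And>\<alpha> \<beta>. \<alpha> \<in> \<Delta> \<Longrightarrow> \<beta> \<in> \<Delta> \<Longrightarrow> \<alpha> \<noteq> \<beta> \<Longrightarrow> \<alpha> \<bullet> \<beta> \<le> 0"
proof -
  obtain t where t: "\<forall>\<alpha>\<in>\<Phi>. t \<bullet> \<alpha> \<noteq> 0" and P: "P = {\<alpha>\<in>\<Phi>. t \<bullet> \<alpha> > 0}"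
    using assms unfolding positive_subsystem_def by blast
  have "finite P"
    using P finite_roots by simp
  have sign: "\<alpha> \<in> P \<or> - \<alpha> \<in> P" if "\<alpha> \<in> \<Phi>" for \<alpha>
    using that t P uminus_root[OF that] by (auto simp: neq_iff)
  define \<Delta> where "\<Delta> = {\<alpha> \<in> P. \<not> (\<exists>\<beta>\<in>P. \<exists>\<delta>\<in>P. \<alpha> = \<beta> + \<delta>)}"
  have "finite \<Delta>"
    using \<open>finite P\<close> by (simp add: \<Delta>_def)
  have obtuse: "\<alpha> \<bullet> \<beta> \<le> 0" if "\<alpha> \<in> \<Delta>" "\<beta> \<in> \<Delta>" "\<alpha> \<noteq> \<beta>" for \<alpha> \<beta>
  proof (rule ccontr)
    assume "\<not> \<alpha> \<bullet> \<beta> \<le> 0"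
    then have "\<alpha> - \<beta> \<in> \<Phi>"
      using that by (intro diff_root) (auto simp: \<Delta>_def P)
    moreover have "\<alpha> = \<beta> + (\<alpha> - \<beta>)" "\<beta> = \<alpha> + - (\<alpha> - \<beta>)" "\<alpha> \<in> P" "\<beta> \<in> P"
      using that by (simp_all add: \<Delta>_def)
    ultimately show False
      using sign[of "\<alpha> - \<beta>"] that(1,2) unfolding \<Delta>_def by blast
  qed
  have P_span: "\<alpha> \<in> nat_span \<Delta>" if "\<alpha> \<in> P" for \<alpha>
    using that
  \<comment> \<open>The values \<open>t \<bullet> \<alpha>\<close> are real and not well-founded in
    themselves; the number of positive roots below \<alpha> is a natural number that drops for both
    summands.\<close>
  proof (induction "card {\<beta> \<in> P. t \<bullet> \<beta> < t \<bullet> \<alpha>}" arbitrary: \<alpha> rule: less_induct)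
    case less
    have smaller: "card {\<beta> \<in> P. t \<bullet> \<beta> < t \<bullet> \<mu>} < card {\<beta> \<in> P. t \<bullet> \<beta> < t \<bullet> \<alpha>}"
      if "\<mu> \<in> P" "t \<bullet> \<mu> < t \<bullet> \<alpha>" for \<mu>
      using that \<open>finite P\<close> by (intro psubset_card_mono) auto
    show ?case
    proof (cases "\<alpha> \<in> \<Delta>")
      case True
      then show ?thesis
        by (rule nat_span_base[OF \<open>finite \<Delta>\<close>])
    next
      case False
      then obtain \<beta> \<delta> where "\<beta> \<in> P" "\<delta> \<in> P" "\<alpha> = \<beta> + \<delta>"
        using less.prems by (auto simp: \<Delta>_def)
      moreover have "t \<bullet> \<beta> < t \<bullet> \<alpha>" "t \<bullet> \<delta> < t \<bullet> \<alpha>"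
        using calculation P by (auto simp: inner_add_right)
      ultimately show ?thesis
        using less.hyps[OF smaller] nat_span_add[of \<beta> \<Delta> \<delta>] by simp
    qed
  qed
  have "independent \<Delta>"
    using obtuse by (intro obtuse_imp_independent[OF \<open>finite \<Delta>\<close>, of t]) (auto simp: \<Delta>_def P)
  moreover have "\<Phi> \<subseteq> span \<Delta>"
  proof
    fix \<alpha> assume "\<alpha> \<in> \<Phi>"
    then have "\<alpha> \<in> span \<Delta> \<or> - \<alpha> \<in> span \<Delta>"
      using sign P_span nat_span_subset_span by blast
    then show "\<alpha> \<in> span \<Delta>"
      using span_neg by fastforce
  qed
  then have "span \<Delta> = UNIV"
    using span_mono[of \<Phi> "span \<Delta>"] span_roots by (simp add: span_span top_unique)
  moreover have "\<Delta> \<subseteq> \<Phi>"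
    by (auto simp: \<Delta>_def P)
  ultimately have "root_base \<Phi> \<Delta>"
    unfolding root_base_def using sign P_span by blast
  then show thesis
    using that[of \<Delta>] obtuse P_span by (auto simp: \<Delta>_def)
qed

end

section \<open>Connectedness and positivity properties of a base\<close>

context root_sys_base
begin

text \<open>If \<open>S\<close> were orthogonal to the other simple roots, each simple reflection
  would preserve one of the two spans and fix the other pointwise. All roots would then lie in one
  of the spans, which splits \<open>\<Phi>\<close>.\<close>

lemma irreducible_base_connected:
  assumes irred: "irreducible_roots \<Phi>" and S: "S \<subseteq> \<Delta>" "S \<noteq> {}" "S \<noteq> \<Delta>"
  shows "\<exists>\<alpha>\<in>S. \<exists>\<beta>\<in>\<Delta> - S. \<alpha> \<bullet> \<beta> \<noteq> 0"
proof (rule ccontr)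
  let ?T = "\<Delta> - S"
  assume contr: "\<not> ?thesis"
  have orth: "v \<bullet> w = 0" if "v \<in> span S" "w \<in> span ?T" for v w
  proof -
    have "orthogonal \<alpha> w" if "\<alpha> \<in> S" for \<alpha>
      using \<open>w \<in> span ?T\<close> contr that
      by (intro orthogonal_to_span[of w ?T]) (auto simp: orthogonal_def)
    then have "orthogonal w v"
      by (intro orthogonal_to_span[OF that(1)]) (simp add: orthogonal_commute)
    then show ?thesis
      by (simp add: orthogonal_def inner_commute)
  qed
  have pos: "\<beta> \<in> span S \<or> \<beta> \<in> span ?T" if "\<beta> \<in> \<Phi>" "\<beta> \<in> nat_span \<Delta>" for \<beta>
    using that
  proof (induction rule: positive_root_induct)
    case (simple \<alpha>)
    then show ?case
      by (auto intro: span_base)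
  next
    case (reflection \<alpha> \<mu>)
    have fixed: "reflection \<alpha> \<mu> = \<mu>" if "\<mu> \<bullet> \<alpha> = 0"
      using that by (simp add: reflection_def)
    have "\<alpha> \<in> span S \<or> \<alpha> \<in> span ?T"
      using reflection(1) by (auto intro: span_base)
    moreover have "reflection \<alpha> \<mu> \<in> span D" if "\<alpha> \<in> span D" "\<mu> \<in> span D" for D
      using that by (simp add: reflection_eq_cartan_int span_diff span_scale)
    ultimately show ?case
      using reflection(2) fixed orth inner_commute by metis
  qed
  have cover: "\<beta> \<in> span S \<or> \<beta> \<in> span ?T" if "\<beta> \<in> \<Phi>" for \<beta>
    using root_sign[OF that] pos[OF that] pos[OF uminus_root[OF that]] span_neg by fastforce
  let ?A = "\<Phi> \<inter> span S" and ?B = "\<Phi> \<inter> span ?T"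
  obtain \<alpha> \<beta> where "\<alpha> \<in> S" "\<beta> \<in> ?T"
    using S by blast
  then have "\<alpha> \<in> ?A" "\<beta> \<in> ?B"
    using S(1) simple_root by (auto intro: span_base)
  then have "?A \<noteq> {}" "?B \<noteq> {}"
    by blast+
  moreover have "?A \<union> ?B = \<Phi>"
    using cover by blast
  moreover have "v \<notin> ?B" if "v \<in> ?A" for v
    using orth[of v v] root_nonzero[of v] that by auto
  then have "?A \<inter> ?B = {}"
    by blast
  moreover have "\<forall>\<alpha>\<in>?A. \<forall>\<beta>\<in>?B. \<alpha> \<bullet> \<beta> = 0"
    using orth by simp
  ultimately have "\<exists>A B. A \<noteq> {} \<and> B \<noteq> {} \<and> A \<union> B = \<Phi> \<and> A \<inter> B = {} \<and>
      (\<forall>\<alpha>\<in>A. \<forall>\<beta>\<in>B. \<alpha> \<bullet> \<beta> = 0)"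
    by (intro exI[of _ ?A] exI[of _ ?B] conjI)
  then show False
    using irred by (simp add: irreducible_roots_def)
qed

text \<open>The row sum of \<beta> is \<beta> \<bullet> c, where c is the sum of the simple coroots
  of \<open>F\<close>. If no row sum were positive, c \<bullet> c would be nonpositive, contrary to
  the independence of the simple roots.\<close>

lemma ex_positive_row:
  assumes "F \<subseteq> \<Delta>" "F \<noteq> {}"
  shows "\<exists>\<beta>\<in>F. (\<Sum>\<alpha>\<in>F. cartan_int \<beta> \<alpha>) > 0"
proof (rule ccontr)
  assume contr: "\<not> ?thesis"
  define c where "c = (\<Sum>\<alpha>\<in>F. (2 / (\<alpha> \<bullet> \<alpha>)) *\<^sub>R \<alpha>)"
  have "finite F"
    using assms(1) finite_base finite_subset by blast
  have row: "\<beta> \<bullet> c = (\<Sum>\<alpha>\<in>F. cartan_int \<beta> \<alpha>)" for \<beta>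
    by (simp add: c_def inner_sum_right cartan_int_def)
  have "c \<bullet> c = (\<Sum>\<beta>\<in>F. 2 / (\<beta> \<bullet> \<beta>) * (\<beta> \<bullet> c))"
    by (subst (1) c_def) (simp add: inner_sum_left)
  also have "\<dots> \<le> 0"
    using contr by (intro sum_nonpos mult_nonneg_nonpos) (auto simp: row not_less)
  finally have "c = 0"
    by (metis inner_gt_zero_iff not_le)
  obtain \<beta> where "\<beta> \<in> F"
    using assms(2) by blast
  have "coord \<beta> c = (\<Sum>\<alpha>\<in>F. if \<alpha> = \<beta> then 2 / (\<alpha> \<bullet> \<alpha>) else 0)"
    unfolding c_def linear_sum[OF linear_coord]
    using assms(1) by (intro sum.cong) (auto simp: linear_cmul[OF linear_coord] coord_simple)
  also have "\<dots> = 2 / (\<beta> \<bullet> \<beta>)"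
    using \<open>\<beta> \<in> F\<close> \<open>finite F\<close> by simp
  finally show False
    using \<open>c = 0\<close> \<open>\<beta> \<in> F\<close> assms(1) simple_root root_nonzero linear_0[OF linear_coord, of \<beta>] by auto
qed

text \<open>Orthogonality makes the reflection in \<alpha> simply reverse the \<alpha>-coordinate.
  When that coordinate is nonzero, the positive root becomes nonpositive, and \<alpha> is the only
  positive root to which this can happen.\<close>

lemma root_in_orthogonal_simple_roots:
  assumes x: "x \<in> \<Phi>" "x \<in> nat_span \<Delta>"
    and N: "N \<subseteq> \<Delta>" "\<And>\<alpha> \<delta>. \<alpha> \<in> N \<Longrightarrow> \<delta> \<in> N \<Longrightarrow> \<alpha> \<noteq> \<delta> \<Longrightarrow> \<alpha> \<bullet> \<delta> = 0"
    and supp: "\<And>\<delta>. \<delta> \<in> \<Delta> - N \<Longrightarrow> coord \<delta> x = 0"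
  shows "x \<in> N"
proof -
  have "finite N"
    using N(1) finite_base finite_subset by blast
  have x_eq: "x = (\<Sum>\<delta>\<in>N. coord \<delta> x *\<^sub>R \<delta>)"
    by (subst sum_coord[symmetric], rule sum.mono_neutral_right) (auto simp: N finite_base supp)
  obtain \<alpha> where \<alpha>: "\<alpha> \<in> N" "coord \<alpha> x \<noteq> 0"
    using x_eq root_nonzero[OF x(1)] by (metis (no_types, lifting) scale_zero_left sum.neutral)
  have "\<alpha> \<in> \<Delta>"
    using \<alpha> N by blast
  have "x \<bullet> \<alpha> = (\<Sum>\<delta>\<in>N. if \<delta> = \<alpha> then coord \<alpha> x * (\<alpha> \<bullet> \<alpha>) else 0)"
    by (subst x_eq, unfold inner_sum_left, rule sum.cong) (auto simp: N(2) \<alpha>(1))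
  then have "x \<bullet> \<alpha> = coord \<alpha> x * (\<alpha> \<bullet> \<alpha>)"
    using \<open>finite N\<close> \<alpha>(1) by simp
  then have "reflection \<alpha> x = x - (2 * coord \<alpha> x) *\<^sub>R \<alpha>"
    using root_nonzero[OF simple_root[OF \<open>\<alpha> \<in> \<Delta>\<close>]] by (simp add: reflection_def)
  then have "coord \<alpha> (reflection \<alpha> x) = - coord \<alpha> x"
    using \<open>\<alpha> \<in> \<Delta>\<close>
    by (simp add: linear_diff[OF linear_coord] linear_cmul[OF linear_coord] coord_simple)
  then have "reflection \<alpha> x \<notin> nat_span \<Delta>"
    using coord_nonneg[OF x(2) \<open>\<alpha> \<in> \<Delta>\<close>] coord_nonneg[OF _ \<open>\<alpha> \<in> \<Delta>\<close>] \<alpha>(2) by force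
  then have "x = \<alpha>"
    using reflection_positive[OF x \<open>\<alpha> \<in> \<Delta>\<close>] by blast
  then show ?thesis
    using \<alpha>(1) by simp
qed

end

section \<open>Equal lengths force a path\<close>

text \<open>A longest path from \<open>b\<close> is taken. Each of its vertices before the last
  already has all its neighbours on the path, and an edge leaving from the last vertex would extend
  it; connectedness then makes the path exhaust \<open>V\<close>.\<close>

lemma path_enumeration:
  fixes V :: "'a set"
  assumes fin: "finite V" and b: "b \<in> V"
    and sym: "\<And>x y. adj x y \<Longrightarrow> adj y x"
    and degree: "\<And>x u v w. {x, u, v, w} \<subseteq> V \<Longrightarrow> adj x u \<Longrightarrow> adj x v \<Longrightarrow> adj x w \<Longrightarrow>
      u = v \<or> u = w \<or> v = w"
    and endpoint: "\<And>u v. {u, v} \<subseteq> V \<Longrightarrow> adj b u \<Longrightarrow> adj b v \<Longrightarrow> u = v"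
    and connected: "\<And>S. S \<subseteq> V \<Longrightarrow> S \<noteq> {} \<Longrightarrow> S \<noteq> V \<Longrightarrow> \<exists>x\<in>S. \<exists>y\<in>V - S. adj x y"
  obtains p where "distinct p" "set p = V" "p ! 0 = b"
    "\<And>i j. i < j \<Longrightarrow> j < length p \<Longrightarrow> adj (p ! i) (p ! j) \<longleftrightarrow> j = Suc i"
proof -
  define path where "path p \<longleftrightarrow> distinct p \<and> set p \<subseteq> V \<and> p \<noteq> [] \<and> p ! 0 = b \<and>
    (\<forall>i. Suc i < length p \<longrightarrow> adj (p ! i) (p ! Suc i))" for p
  have "path [b]"
    using b by (simp add: path_def)
  moreover have "\<forall>p. path p \<longrightarrow> length p < Suc (card V)"
    unfolding path_def using fin by (metis card_mono distinct_card le_imp_less_Suc)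
  ultimately obtain p where p: "path p" and max: "\<And>q. path q \<Longrightarrow> length q \<le> length p"
    using ex_has_greatest_nat[of path "[b]" length "Suc (card V)"] by blast
  have dist: "distinct p" and sub: "set p \<subseteq> V" and ne: "p \<noteq> []" and hd: "p ! 0 = b"
    and step: "\<And>i. Suc i < length p \<Longrightarrow> adj (p ! i) (p ! Suc i)"
    using p by (auto simp: path_def)
  have inV: "p ! i \<in> V" if "i < length p" for i
    using that sub nth_mem by blast
  \<comment> \<open>Stated for vertices before the last only. This also excludes chords, since the
    smaller index of a chord is never the last.\<close>
  have neighbour: "y = p ! Suc i \<or> (i > 0 \<and> y = p ! (i - 1))"
    if "Suc i < length p" "y \<in> V" "adj (p ! i) y" for i y
  proof (cases "i = 0")
    case True
    then show ?thesis
      using endpoint[of y "p ! 1"] step[of 0] that hd inV[of 1] by auto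
  next
    case False
    then have "adj (p ! i) (p ! (i - 1))"
      using step[of "i - 1"] that(1) sym by simp
    moreover have "p ! (i - 1) \<noteq> p ! Suc i"
      using dist that(1) by (simp add: nth_eq_iff_index_eq)
    ultimately show ?thesis
      using degree[of "p ! i" y "p ! Suc i" "p ! (i - 1)"] step[OF that(1)] that False
        inV[of i] inV[of "Suc i"] inV[of "i - 1"] by auto
  qed
  have "set p = V"
  proof (rule ccontr)
    assume "set p \<noteq> V"
    then obtain x y where xy: "x \<in> set p" "y \<in> V - set p" "adj x y"
      using connected[OF sub] ne by auto
    then obtain i where i: "i < length p" "x = p ! i"
      by (auto simp: in_set_conv_nth)
    show False
    proof (cases "Suc i < length p")
      case True
      then show False
        using neighbour[OF True, of y] xy i by auto
    next
      case False
      then have last: "Suc i = length p"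
        using i by simp
      have "adj ((p @ [y]) ! k) ((p @ [y]) ! Suc k)" if "Suc k < length (p @ [y])" for k
        using that step[of k] last xy(3) i(2) by (cases "k = i") (auto simp: nth_append)
      then have "path (p @ [y])"
        using xy(2) dist sub ne hd by (auto simp: path_def nth_append)
      then show False
        using max by fastforce
    qed
  qed
  moreover have "adj (p ! i) (p ! j) \<longleftrightarrow> j = Suc i" if "i < j" "j < length p" for i j
  proof
    assume "adj (p ! i) (p ! j)"
    then have "p ! j = p ! Suc i \<or> (i > 0 \<and> p ! j = p ! (i - 1))"
      using neighbour[of i "p ! j"] that inV by simp
    then show "j = Suc i"
      using that dist by (auto simp: nth_eq_iff_index_eq)
  next
    assume "j = Suc i"
    then show "adj (p ! i) (p ! j)"
      using step that by simp
  qed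
  ultimately show thesis
    using that dist hd by blast
qed

section \<open>Row sums of the Cartan matrix when the two lengths agree\<close>

locale equal_lengths = root_sys_base \<Phi> \<Delta> for \<Phi> \<Delta> :: "'a::euclidean_space set" +
  fixes P :: "'a set"
  assumes simple_positive: "\<Delta> \<subseteq> P" and positive_root: "P \<subseteq> \<Phi>"
    and positive_nat_span: "P \<subseteq> nat_span \<Delta>"
    and obtuse: "\<And>\<alpha> \<beta>. \<alpha> \<in> \<Delta> \<Longrightarrow> \<beta> \<in> \<Delta> \<Longrightarrow> \<alpha> \<noteq> \<beta> \<Longrightarrow> \<alpha> \<bullet> \<beta> \<le> 0"
    and irreducible: "irreducible_roots \<Phi>"
    and equal_length: "\<And>\<gamma>. \<gamma> \<in> nat_span P \<Longrightarrow> sum_length P \<gamma> = sum_length \<Phi> \<gamma>"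
begin

lemma neg_cartan_Nats:
  assumes "\<alpha> \<in> \<Delta>" "\<beta> \<in> \<Delta>" "\<beta> \<noteq> \<alpha>"
  shows "- cartan_int \<beta> \<alpha> \<in> \<nat>"
proof -
  obtain k :: int where k: "cartan_int \<beta> \<alpha> = k"
    using cartan_int_Ints simple_root assms(1,2) by (meson Ints_cases)
  moreover have "cartan_int \<beta> \<alpha> \<le> 0"
    using obtuse[OF assms(2,1,3)] by (simp add: cartan_int_def divide_nonpos_nonneg)
  ultimately have "- cartan_int \<beta> \<alpha> = real (nat (- k))"
    by simp
  then show ?thesis
    by (metis of_nat_in_Nats)
qed

lemma neg_cartan_nonneg: "\<alpha> \<in> \<Delta> \<Longrightarrow> \<beta> \<in> \<Delta> \<Longrightarrow> \<beta> \<noteq> \<alpha> \<Longrightarrow> - cartan_int \<beta> \<alpha> \<ge> 0"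
  using neg_cartan_Nats Nats_cases by (metis of_nat_0_le_iff)

lemma neg_cartan_ge_1:
  assumes "\<alpha> \<in> \<Delta>" "\<beta> \<in> \<Delta>" "\<beta> \<noteq> \<alpha>" "\<beta> \<bullet> \<alpha> \<noteq> 0"
  shows "- cartan_int \<beta> \<alpha> \<ge> 1"
proof -
  obtain k where k: "- cartan_int \<beta> \<alpha> = real k"
    using neg_cartan_Nats[OF assms(1-3)] by (rule Nats_cases)
  moreover have "cartan_int \<beta> \<alpha> \<noteq> 0"
    using assms simple_root root_nonzero by (auto simp: cartan_int_def)
  ultimately show ?thesis
    by (cases k) auto
qed

text \<open>On three mutually adjacent simple roots every row sum would be at most 2 - 1 - 1 = 0,
  against \<open>ex_positive_row\<close>. Hence the neighbours of a simple root are mutually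
  orthogonal.\<close>

lemma no_triangle:
  assumes "\<alpha> \<in> \<Delta>" "\<beta> \<in> \<Delta>" "\<delta> \<in> \<Delta>" "\<alpha> \<noteq> \<beta>" "\<delta> \<noteq> \<beta>" "\<alpha> \<noteq> \<delta>" "\<beta> \<bullet> \<alpha> \<noteq> 0" "\<beta> \<bullet> \<delta> \<noteq> 0"
  shows "\<alpha> \<bullet> \<delta> = 0"
proof (rule ccontr)
  assume "\<alpha> \<bullet> \<delta> \<noteq> 0"
  then have ge: "- cartan_int x y \<ge> 1" if "x \<in> {\<alpha>, \<beta>, \<delta>}" "y \<in> {\<alpha>, \<beta>, \<delta>}" "x \<noteq> y" for x y
    using that assms by (intro neg_cartan_ge_1) (auto simp: inner_commute)
  have "cartan_int x x = 2" if "x \<in> {\<alpha>, \<beta>, \<delta>}" for x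
    using that assms(1-3) simple_root root_nonzero by (intro cartan_int_self) blast
  then have "(\<Sum>y\<in>{\<alpha>, \<beta>, \<delta>}. cartan_int x y) \<le> 0" if "x \<in> {\<alpha>, \<beta>, \<delta>}" for x
    using that ge[of \<alpha> \<beta>] ge[of \<alpha> \<delta>] ge[of \<beta> \<alpha>] ge[of \<beta> \<delta>] ge[of \<delta> \<alpha>] ge[of \<delta> \<beta>] assms(4-6)
    by auto
  then show False
    using ex_positive_row[of "{\<alpha>, \<beta>, \<delta>}"] assms(1-3) by fastforce
qed

text \<open>If \<open>N\<close> is the set of neighbours of the simple root \<open>\<beta>\<close>, reflecting \<open>\<beta>\<close> in all of \<open>N\<close> gives a
  root \<open>\<beta> + \<gamma>\<close>. Then \<open>\<gamma> = (\<beta> + \<gamma>) - \<beta>\<close> has length at most 2, whereas the only positive roots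
  available to write \<open>\<gamma>\<close> are the elements of \<open>N\<close>.\<close>

lemma row_sum_le_2:
  assumes \<beta>: "\<beta> \<in> \<Delta>"
  shows "(\<Sum>\<alpha>\<in>\<Delta> - {\<beta>}. - cartan_int \<beta> \<alpha>) \<le> 2"
proof -
  define N where "N = {\<alpha> \<in> \<Delta> - {\<beta>}. \<beta> \<bullet> \<alpha> \<noteq> 0}"
  have N: "N \<subseteq> \<Delta>" "\<beta> \<notin> N" "finite N"
    using finite_base by (auto simp: N_def)
  have orth: "\<alpha> \<bullet> \<delta> = 0" if "\<alpha> \<in> N" "\<delta> \<in> N" "\<alpha> \<noteq> \<delta>" for \<alpha> \<delta>
    using that \<beta> by (intro no_triangle[of \<alpha> \<beta> \<delta>]) (auto simp: N_def)
  \<comment> \<open>As the neighbours are orthogonal, reflections already performed do not change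
    the pairing with the next coroot, which is still that of \<beta>.\<close>
  have reflected: "\<beta> + (\<Sum>\<alpha>\<in>F. (- cartan_int \<beta> \<alpha>) *\<^sub>R \<alpha>) \<in> \<Phi>" if "F \<subseteq> N" for F
    using finite_subset[OF that N(3)] that
  proof (induction F rule: finite_induct)
    case empty
    then show ?case using simple_root[OF \<beta>] by simp
  next
    case (insert \<alpha> F)
    let ?v = "\<beta> + (\<Sum>\<alpha>\<in>F. (- cartan_int \<beta> \<alpha>) *\<^sub>R \<alpha>)"
    have "(\<Sum>\<delta>\<in>F. (- cartan_int \<beta> \<delta>) *\<^sub>R \<delta>) \<bullet> \<alpha> = 0"
      unfolding inner_sum_left using insert orth by (intro sum.neutral) auto
    then have "cartan_int ?v \<alpha> = cartan_int \<beta> \<alpha>"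
      by (simp add: cartan_int_def inner_add_left)
    then have "reflection \<alpha> ?v = \<beta> + (\<Sum>\<alpha>\<in>insert \<alpha> F. (- cartan_int \<beta> \<alpha>) *\<^sub>R \<alpha>)"
      using insert.hyps by (simp add: reflection_eq_cartan_int)
    moreover have "\<alpha> \<in> \<Phi>" "?v \<in> \<Phi>"
      using insert N(1) simple_root by blast+
    ultimately show ?case
      using reflection_root by metis
  qed
  define \<gamma> where "\<gamma> = (\<Sum>\<alpha>\<in>N. (- cartan_int \<beta> \<alpha>) *\<^sub>R \<alpha>)"
  have "finite P"
    using positive_root finite_roots finite_subset by blast
  \<comment> \<open>The coefficients are natural numbers, so the floor loses nothing; the value 0
    outside \<open>N\<close> lets the sum run over all of \<open>P\<close>.\<close>
  define k where "k \<alpha> = (if \<alpha> \<in> N then nat \<lfloor>- cartan_int \<beta> \<alpha>\<rfloor> else 0)" for \<alpha>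
  have k: "real (k \<alpha>) = - cartan_int \<beta> \<alpha>" if "\<alpha> \<in> N" for \<alpha>
    using neg_cartan_Nats[of \<alpha> \<beta>] that \<beta> N(1,2) by (force simp: k_def elim!: Nats_cases)
  have "\<gamma> = (\<Sum>\<alpha>\<in>N. real (k \<alpha>) *\<^sub>R \<alpha>)"
    by (simp add: \<gamma>_def k)
  also have "\<dots> = (\<Sum>\<alpha>\<in>P. real (k \<alpha>) *\<^sub>R \<alpha>)"
    using N(1) simple_positive \<open>finite P\<close> by (intro sum.mono_neutral_left) (auto simp: k_def)
  finally have \<gamma>_span: "\<gamma> \<in> nat_span P"
    by (rule nat_spanI)
  have "sum_length \<Phi> \<gamma> \<le> length [\<beta> + \<gamma>, - \<beta>]"
    using reflected[of N] uminus_root[OF simple_root[OF \<beta>]]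
    by (intro sum_length_le) (auto simp: \<gamma>_def)
  then have "sum_length P \<gamma> \<le> 2"
    using equal_length[OF \<gamma>_span] by simp
  moreover obtain xs where "length xs = sum_length P \<gamma>" and xs: "set xs \<subseteq> P" "sum_list xs = \<gamma>"
    using nat_span_imp_sum_list[OF \<open>finite P\<close> \<gamma>_span] sum_length_attained by metis
  ultimately have "length xs \<le> 2"
    by simp
  have sum_linear: "\<phi> (sum_list ys) = (\<Sum>y\<leftarrow>ys. \<phi> y)" if "linear \<phi>" for \<phi> :: "'a \<Rightarrow> real" and ys
    by (induction ys) (simp_all add: linear_0[OF that] linear_add[OF that])
  \<comment> \<open>The summands are positive roots, so their coordinates cannot cancel: where
    \<gamma> has coordinate 0, each summand has.\<close>
  have coord_0: "coord \<delta> x = 0" if "x \<in> set xs" "\<delta> \<in> \<Delta> - N" for x \<delta>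
  proof -
    have "coord \<delta> \<alpha> = 0" if "\<alpha> \<in> N" for \<alpha>
      using that \<open>\<delta> \<in> \<Delta> - N\<close> N(1) by (subst coord_simple) auto
    then have "coord \<delta> \<gamma> = 0"
      unfolding \<gamma>_def linear_sum[OF linear_coord]
      by (simp add: linear_neg[OF linear_coord] linear_cmul[OF linear_coord])
    then have "(\<Sum>y\<leftarrow>xs. coord \<delta> y) = 0"
      using sum_linear[OF linear_coord, of \<delta> xs] xs(2) by simp
    moreover have "coord \<delta> y \<ge> 0" if "y \<in> set xs" for y
      using coord_nonneg that xs(1) positive_nat_span \<open>\<delta> \<in> \<Delta> - N\<close> by blast
    ultimately show ?thesis
      using that(1) sum_list_nonneg_eq_0_iff[of "map (coord \<delta>) xs"] by auto
  qed
  have "x \<in> N" if "x \<in> set xs" for x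
  proof (rule root_in_orthogonal_simple_roots[OF _ _ N(1) orth coord_0[OF that]])
    show "x \<in> \<Phi>" "x \<in> nat_span \<Delta>"
      using that xs(1) positive_root positive_nat_span by blast+
  qed
  \<comment> \<open>The height functional. Its value at \<gamma> is the row sum by definition of
    \<gamma>, and it is the number of summands because all summands are simple.\<close>
  obtain h :: "'a \<Rightarrow> real" where "linear h" and h: "\<forall>\<alpha>\<in>\<Delta>. h \<alpha> = 1"
    using linear_independent_extend[OF independent_base, of "\<lambda>_. 1"] by blast
  have "(\<Sum>\<alpha>\<in>\<Delta> - {\<beta>}. - cartan_int \<beta> \<alpha>) = (\<Sum>\<alpha>\<in>N. - cartan_int \<beta> \<alpha>)"
    using finite_base by (intro sum.mono_neutral_right) (auto simp: N_def cartan_int_def)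
  also have "\<dots> = h \<gamma>"
    using h N(1) by (auto simp: \<gamma>_def linear_sum[OF \<open>linear h\<close>] linear_cmul[OF \<open>linear h\<close>]
        linear_neg[OF \<open>linear h\<close>] intro!: sum.cong)
  also have "\<dots> = (\<Sum>y\<leftarrow>xs. h y)"
    using sum_linear[OF \<open>linear h\<close>] xs(2) by metis
  also have "map h xs = map (\<lambda>_. 1) xs"
    using \<open>\<And>x. x \<in> set xs \<Longrightarrow> x \<in> N\<close> h N(1) by auto
  also have "sum_list \<dots> = length xs"
    by (simp add: sum_list_triv)
  finally show ?thesis
    using \<open>length xs \<le> 2\<close> by simp
qed

lemma partial_row_sum_le:
  assumes "\<beta> \<in> \<Delta>" "F \<subseteq> \<Delta> - {\<beta>}"
  shows "(\<Sum>\<alpha>\<in>F. - cartan_int \<beta> \<alpha>) \<le> (\<Sum>\<alpha>\<in>\<Delta> - {\<beta>}. - cartan_int \<beta> \<alpha>)"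
  using assms finite_base by (intro sum_mono2) (auto intro!: neg_cartan_nonneg[simplified])

text \<open>Each neighbour takes at least 1 from the budget of a row, which is 2, or 1 for the
  starting vertex \<open>b\<close>. Every row before the last is thereby forced to have entries -1
  only, while the last row may spend its whole budget on one neighbour.\<close>

lemma type_A_or_C: "(\<exists>l\<ge>1. type_A \<Phi> l) \<or> (\<exists>l\<ge>2. type_C \<Phi> l)"
proof -
  define adj where "adj \<alpha> \<beta> \<longleftrightarrow> \<alpha> \<noteq> \<beta> \<and> \<alpha> \<bullet> \<beta> \<noteq> 0" for \<alpha> \<beta> :: 'a
  have self: "cartan_int \<alpha> \<alpha> = 2" if "\<alpha> \<in> \<Delta>" for \<alpha>
    using that simple_root root_nonzero cartan_int_self by blast
  have ge_1: "- cartan_int \<beta> \<alpha> \<ge> 1" if "\<beta> \<in> \<Delta>" "\<alpha> \<in> \<Delta>" "adj \<beta> \<alpha>" for \<alpha> \<beta>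
    using that by (intro neg_cartan_ge_1) (auto simp: adj_def)
  have "\<Delta> \<noteq> {}"
    using span_simple_roots irreducible root_nonzero by (force simp: irreducible_roots_def)
  then obtain b where b: "b \<in> \<Delta>" "(\<Sum>\<alpha>\<in>\<Delta>. cartan_int b \<alpha>) > 0"
    using ex_positive_row[of \<Delta>] by blast
  define r where "r = (\<Sum>\<alpha>\<in>\<Delta> - {b}. - cartan_int b \<alpha>)"
  have "r < 2"
    using b self[of b] finite_base by (simp add: r_def sum_negf sum_diff1)
  moreover have "r \<in> \<nat>"
  proof -
    have "(\<Sum>\<alpha>\<in>A. - cartan_int b \<alpha>) \<in> \<nat>" if "A \<subseteq> \<Delta> - {b}" for A
      using finite_subset[OF that] finite_base that neg_cartan_Nats[OF _ b(1)]
      by (induction A rule: infinite_finite_induct)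
        (auto intro!: Nats_add simp del: add_uminus_conv_diff uminus_add_conv_diff)
    then show ?thesis
      by (simp add: r_def)
  qed
  ultimately have r: "r \<le> 1"
    by (auto elim!: Nats_cases)
  obtain p where dist: "distinct p" and set_p: "set p = \<Delta>" and p0: "p ! 0 = b"
    and adj_p: "\<And>i j. i < j \<Longrightarrow> j < length p \<Longrightarrow> adj (p ! i) (p ! j) \<longleftrightarrow> j = Suc i"
  proof (rule path_enumeration[OF finite_base b(1), of adj])
    show "adj y x" if "adj x y" for x y
      using that by (auto simp: adj_def inner_commute)
  next
    fix x u v w assume *: "{x, u, v, w} \<subseteq> \<Delta>" "adj x u" "adj x v" "adj x w"
    show "u = v \<or> u = w \<or> v = w"
    proof (rule ccontr)
      assume "\<not> ?thesis"
      then have "(\<Sum>\<alpha>\<in>{u, v, w}. - cartan_int x \<alpha>) \<ge> 3"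
        using ge_1[of x u] ge_1[of x v] ge_1[of x w] * by simp
      moreover have "{u, v, w} \<subseteq> \<Delta> - {x}"
        using * by (auto simp: adj_def)
      ultimately show False
        using partial_row_sum_le[of x "{u, v, w}"] row_sum_le_2[of x] * by simp
    qed
  next
    fix u v assume *: "{u, v} \<subseteq> \<Delta>" "adj b u" "adj b v"
    show "u = v"
    proof (rule ccontr)
      assume "u \<noteq> v"
      then have "(\<Sum>\<alpha>\<in>{u, v}. - cartan_int b \<alpha>) \<ge> 2"
        using ge_1[of b u] ge_1[of b v] * b(1) by simp
      moreover have "{u, v} \<subseteq> \<Delta> - {b}"
        using * by (auto simp: adj_def)
      ultimately show False
        using partial_row_sum_le[of b "{u, v}"] r b(1) by (simp add: r_def)
    qed
  next
    fix S assume "S \<subseteq> \<Delta>" "S \<noteq> {}" "S \<noteq> \<Delta>"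
    then obtain x y where "x \<in> S" "y \<in> \<Delta> - S" "x \<bullet> y \<noteq> 0"
      using irreducible_base_connected[OF irreducible, of S] by blast
    then show "\<exists>x\<in>S. \<exists>y\<in>\<Delta> - S. adj x y"
      by (intro bexI[of _ x] bexI[of _ y]) (auto simp: adj_def)
  qed blast
  define l where "l = length p"
  have in_base: "p ! i \<in> \<Delta>" if "i < l" for i
    using that set_p by (auto simp: l_def)
  have "l \<ge> 1"
    using set_p \<open>\<Delta> \<noteq> {}\<close> by (cases p) (auto simp: l_def)
  have adj_sym: "adj \<alpha> \<beta> \<longleftrightarrow> adj \<beta> \<alpha>" for \<alpha> \<beta>
    by (auto simp: adj_def inner_commute)
  have neq: "p ! i \<noteq> p ! j" if "i < l" "j < l" "i \<noteq> j" for i j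
    using that dist by (simp add: l_def nth_eq_iff_index_eq)
  have zero: "cartan_int (p ! i) (p ! j) = 0"
    if "i < l" "j < l" "i \<noteq> j" "i \<noteq> Suc j" "j \<noteq> Suc i" for i j
    using that adj_p[of i j] adj_p[of j i] adj_sym neq[OF that(1-3)]
    by (cases i j rule: linorder_cases) (auto simp: l_def adj_def cartan_int_def)
  have up: "cartan_int (p ! i) (p ! Suc i) = -1" if "Suc i < l" for i
  proof -
    have up1: "- cartan_int (p ! i) (p ! Suc i) \<ge> 1"
      using ge_1[of "p ! i" "p ! Suc i"] adj_p[of i "Suc i"] that in_base by (simp add: l_def)
    moreover have "- cartan_int (p ! i) (p ! Suc i) \<le> 1"
    proof (cases "i = 0")
      case True
      then show ?thesis
        using partial_row_sum_le[of b "{p ! 1}"] r b(1) p0 in_base[of 1] neq[of 0 1] that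
        by (simp add: r_def)
    next
      case False
      then have "- cartan_int (p ! i) (p ! (i - 1)) \<ge> 1"
        using ge_1[of "p ! i" "p ! (i - 1)"] adj_p[of "i - 1" i] adj_sym that in_base
        by (simp add: l_def)
      moreover have "{p ! Suc i, p ! (i - 1)} \<subseteq> \<Delta> - {p ! i}"
        using in_base neq[of "Suc i" i] neq[of "i - 1" i] that False by simp
      moreover have "p ! Suc i \<noteq> p ! (i - 1)"
        using neq that by simp
      ultimately show ?thesis
        using partial_row_sum_le[of "p ! i" "{p ! Suc i, p ! (i - 1)}"] row_sum_le_2[of "p ! i"]
          in_base[of i] that by simp
    qed
    ultimately show ?thesis
      by simp
  qed
  have down: "cartan_int (p ! Suc i) (p ! i) = -1" if "Suc (Suc i) < l" for i
  proof -
    have "- cartan_int (p ! Suc i) (p ! i) \<ge> 1"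
      using ge_1[of "p ! Suc i" "p ! i"] adj_p[of i "Suc i"] adj_sym that in_base by (simp add: l_def)
    moreover have "{p ! i, p ! Suc (Suc i)} \<subseteq> \<Delta> - {p ! Suc i}"
      using in_base neq[of "Suc i" i] neq[of "Suc i" "Suc (Suc i)"] that by auto
    moreover have "p ! i \<noteq> p ! Suc (Suc i)"
      using neq that by simp
    ultimately show ?thesis
      using partial_row_sum_le[of "p ! Suc i" "{p ! i, p ! Suc (Suc i)}"] row_sum_le_2[of "p ! Suc i"]
        in_base[of "Suc i"] up[of "Suc i"] that by simp
  qed
  define s where "s i = p ! (i - 1)" for i
  have inj: "inj_on s {1..l}"
  proof (rule inj_onI)
    fix i j assume ij: "i \<in> {1..l}" "j \<in> {1..l}" "s i = s j"
    then have "i - 1 < l" "j - 1 < l"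
      by auto
    then have "i - 1 = j - 1"
      using neq ij(3) unfolding s_def by blast
    then show "i = j"
      using ij(1,2) unfolding atLeastAtMost_iff by linarith
  qed
  have "s ` {1..l} = \<Delta>"
  proof -
    have "s ` {1..l} = (\<lambda>i. p ! i) ` {0..<l}"
    proof (intro equalityI subsetI)
      fix x assume "x \<in> (\<lambda>i. p ! i) ` {0..<l}"
      then obtain i where "i < l" "x = s (Suc i)"
        by (auto simp: s_def)
      then show "x \<in> s ` {1..l}"
        by auto
    qed (force simp: s_def)
    then show ?thesis
      using set_p by (auto simp: l_def set_conv_nth)
  qed
  then have matrix: "has_cartan_matrix \<Phi> l M"
    if "\<And>i j. i < l \<Longrightarrow> j < l \<Longrightarrow> cartan_int (p ! i) (p ! j) = M (Suc i) (Suc j)" for M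
    unfolding has_cartan_matrix_def using inj root_base that[of "_ - 1" "_ - 1"]
    by (intro exI[of _ s]) (auto simp: s_def)
  have except_last: "cartan_int (p ! i) (p ! j) = cartan_A (Suc i) (Suc j)"
    if "i < l" "j < l" "\<not> (l = Suc i \<and> i = Suc j)" for i j
    using that self[OF in_base, of i] up[of i] down[of j] zero[of i j]
    by (auto simp: cartan_A_def)
  show ?thesis
  proof (cases "l = 1")
    case True
    then have "type_A \<Phi> l"
      unfolding type_A_def using \<open>l \<ge> 1\<close> except_last by (intro conjI matrix) auto
    then show ?thesis
      using \<open>l \<ge> 1\<close> by blast
  next
    case False
    then obtain n where n: "l = Suc (Suc n)"
      using \<open>l \<ge> 1\<close> by (cases l; cases "l - 1") auto
    let ?\<beta> = "p ! Suc n" and ?\<alpha> = "p ! n"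
    have ends: "?\<alpha> \<in> \<Delta>" "?\<beta> \<in> \<Delta>" "?\<beta> \<noteq> ?\<alpha>"
      using in_base neq n by auto
    obtain k where k: "- cartan_int ?\<beta> ?\<alpha> = real k"
      using neg_cartan_Nats[OF ends] by (rule Nats_cases)
    moreover have "- cartan_int ?\<beta> ?\<alpha> \<ge> 1"
      using ge_1[of ?\<beta> ?\<alpha>] adj_p[of n "Suc n"] adj_sym ends n by (simp add: l_def)
    moreover have "- cartan_int ?\<beta> ?\<alpha> \<le> 2"
      using partial_row_sum_le[of ?\<beta> "{?\<alpha>}"] row_sum_le_2[of ?\<beta>] ends by simp
    ultimately have "k = 1 \<or> k = 2"
      by auto
    then show ?thesis
    proof
      assume "k = 1"
      then have "cartan_int (p ! i) (p ! j) = cartan_A (Suc i) (Suc j)" if "i < l" "j < l" for i j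
        using except_last[OF that] k n by (cases "l = Suc i \<and> i = Suc j") (auto simp: cartan_A_def)
      then have "has_cartan_matrix \<Phi> l cartan_A"
        by (rule matrix)
      then show ?thesis
        using \<open>l \<ge> 1\<close> by (auto simp: type_A_def)
    next
      assume "k = 2"
      then have "cartan_int (p ! i) (p ! j) = cartan_C l (Suc i) (Suc j)" if "i < l" "j < l" for i j
        using except_last[OF that] k n by (cases "l = Suc i \<and> i = Suc j") (auto simp: cartan_C_def)
      then have "has_cartan_matrix \<Phi> l (cartan_C l)"
        by (rule matrix)
      then show ?thesis
        using n by (auto simp: type_C_def)
    qed
  qed
qed

end

theorem corollaryE:
  fixes \<Phi> P :: "'a::euclidean_space set"
  assumes "root_system \<Phi>"
    and "reduced_roots \<Phi>"
    and "crystallographic \<Phi>"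
    and "irreducible_roots \<Phi>"
    and "positive_subsystem \<Phi> P"
  shows "(\<forall>\<gamma>\<in>nat_span P. sum_length P \<gamma> = sum_length \<Phi> \<gamma>) \<longleftrightarrow>
    (\<exists>l\<ge>1. type_A \<Phi> l) \<or> (\<exists>l\<ge>2. type_C \<Phi> l)"
proof -
  interpret root_sys \<Phi>
    using assms by unfold_locales
  show ?thesis
  proof
    assume eq: "\<forall>\<gamma>\<in>nat_span P. sum_length P \<gamma> = sum_length \<Phi> \<gamma>"
    obtain \<Delta> where \<Delta>: "\<Delta> \<subseteq> P" "P \<subseteq> nat_span \<Delta>" "root_base \<Phi> \<Delta>"
      "\<And>\<alpha> \<beta>. \<alpha> \<in> \<Delta> \<Longrightarrow> \<beta> \<in> \<Delta> \<Longrightarrow> \<alpha> \<noteq> \<beta> \<Longrightarrow> \<alpha> \<bullet> \<beta> \<le> 0"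
      using positive_subsystem_base[OF assms(5)] by blast
    have "P \<subseteq> \<Phi>"
      using assms(5) by (auto simp: positive_subsystem_def)
    interpret equal_lengths \<Phi> \<Delta> P
      by unfold_locales (use \<Delta> \<open>P \<subseteq> \<Phi>\<close> assms(4) eq in auto)
    show "(\<exists>l\<ge>1. type_A \<Phi> l) \<or> (\<exists>l\<ge>2. type_C \<Phi> l)"
      by (rule type_A_or_C)
  next
    assume "(\<exists>l\<ge>1. type_A \<Phi> l) \<or> (\<exists>l\<ge>2. type_C \<Phi> l)"
    then show "\<forall>\<gamma>\<in>nat_span P. sum_length P \<gamma> = sum_length \<Phi> \<gamma>"
      using sum_length_eq_if_type_A sum_length_eq_if_type_C assms(5) by blast
  qed
qed

end
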